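(* Let $\hat{A} \in \mathbb{D}\mathbb{C}^{m \times q}$ and $\hat{B} \in \mathbb{D}\mathbb{C}^{q \times n}$ be dual complex matrices. If $$\hat{A}^N\hat{A}\hat{B}\hat{B}^*\hat{A}^*\hat{A}\hat{B}\hat{B}^N=\hat{B}\hat{B}^*\hat{A}^*\hat{A},$$ then $(\hat{A}\hat{B})^N=\hat{B}^N\hat{A}^N$.
   Context: A dual complex number is $\hat a=a_s+a_d\epsilon$ with $a_s,a_d\in\mathbb{C}$, where $\epsilon$ commutes with complex numbers and $\epsilon^2=0$; it is a dual number if $a_s,a_d\in\mathbb{R}$. A dual number is positive appreciable if $a_s>0$, and positive infinitesimal if $a_s=0$ and $a_d>0$. $\mathbb{D}\mathbb{C}^{m\times n}$ is the set of $m\times n$ dual complex matrices $\hat A=A_s+A_d\epsilon$, $A_s,A_d\in\mathbb{C}^{m\times n}$, and $\hat A^*=A_s^*+A_d^*\epsilon$ (conjugate transpose). $\hat U$ (square) is unitary if $\hat U^*\hat U=\hat U\hat U^*=I$. Known fact (SVD): every $\hat A\in\mathbb{D}\mathbb{C}^{m\times n}$ can be written $\hat A=\hat U\begin{bmatrix}\hat\Sigma_1&O\\O&\hat\Sigma_2\end{bmatrix}\hat V^*$ with $\hat U\in\mathbb{D}\mathbb{C}^{m\times m}$, $\hat V\in\mathbb{D}\mathbb{C}^{n\times n}$ unitary, $\hat\Sigma_1=\mathrm{diag}(\hat\mu_1,\dots,\hat\mu_r)$ with positive appreciable dual numbers on the diagonal, and $\hat\Sigma_2$ a (rectangular) diagonal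 matrix with diagonal entries that are positive infinitesimal dual numbers or zero. The essential part of $\hat A$ is $\hat A_e=\hat U\begin{bmatrix}\hat\Sigma_1&O\\O&O\end{bmatrix}\hat V^*$. The new dual Moore-Penrose inverse (NDMPI) $\hat A^N\in\mathbb{D}\mathbb{C}^{n\times m}$ of $\hat A$ is the unique $\hat X$ (known to exist for every $\hat A$) satisfying $\hat A\hat X\hat A=\hat A_e$, $\hat X\hat A\hat X=\hat X$, $(\hat A\hat X)^*=\hat A\hat X$, $(\hat X\hat A)^*=\hat X\hat A$; in terms of the SVD, $\hat A^N=\hat V\begin{bmatrix}\hat\Sigma_1^{-1}&O\\O&O\end{bmatrix}\hat U^*$. *)

theory Defs
  imports Complex_Main "Jordan_Normal_Form.Matrix" "Jordan_Normal_Form.Conjugate"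
begin

section \<open>Dual complex numbers\<close>

text \<open>\<open>DC a b\<close> stands for \<open>a + b\<epsilon>\<close>, where \<open>\<epsilon>\<^sup>2 = 0\<close>.\<close>

datatype dual_complex = DC (std_part: complex) (inf_part: complex)

instantiation dual_complex :: comm_ring_1
begin

definition zero_dual_complex :: dual_complex where
  "0 = DC 0 0"

definition one_dual_complex :: dual_complex where
  "1 = DC 1 0"

definition plus_dual_complex :: "dual_complex \<Rightarrow> dual_complex \<Rightarrow> dual_complex" where
  "x + y = DC (std_part x + std_part y) (inf_part x + inf_part y)"

definition uminus_dual_complex :: "dual_complex \<Rightarrow> dual_complex" where
  "- x = DC (- std_part x) (- inf_part x)"

definition minus_dual_complex :: "dual_complex \<Rightarrow> dual_complex \<Rightarrow> dual_complex" where
  "x - y = DC (std_part x - std_part y) (inf_part x - inf_part y)"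

definition times_dual_complex :: "dual_complex \<Rightarrow> dual_complex \<Rightarrow> dual_complex" where
  "x * y = DC (std_part x * std_part y) (std_part x * inf_part y + inf_part x * std_part y)"

instance
  by standard
    (simp_all add: zero_dual_complex_def one_dual_complex_def plus_dual_complex_def
      uminus_dual_complex_def minus_dual_complex_def times_dual_complex_def algebra_simps)

end

instantiation dual_complex :: conjugatable_ring
begin

definition conjugate_dual_complex :: "dual_complex \<Rightarrow> dual_complex" where
  "conjugate x = DC (cnj (std_part x)) (cnj (inf_part x))"

instance
  by standard
    (auto simp: conjugate_dual_complex_def zero_dual_complex_def plus_dual_complex_def
      uminus_dual_complex_def times_dual_complex_def dual_complex.expand)

end

definition is_dual_number :: "dual_complex \<Rightarrow> bool" where
  "is_dual_number x \<longleftrightarrow> std_part x \<in> \<real> \<and> inf_part x \<in> \<real>"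

definition positive_appreciable :: "dual_complex \<Rightarrow> bool" where
  "positive_appreciable x \<longleftrightarrow> is_dual_number x \<and> Re (std_part x) > 0"

definition positive_infinitesimal :: "dual_complex \<Rightarrow> bool" where
  "positive_infinitesimal x \<longleftrightarrow> is_dual_number x \<and> std_part x = 0 \<and> Re (inf_part x) > 0"

section \<open>Dual complex matrices\<close>

text \<open>
  A dual complex matrix \<open>A\<^sub>s + A\<^sub>d\<epsilon>\<close> is represented as a matrix with entries in
  \<^typ>\<open>dual_complex\<close>. The library's \<open>mat_adjoint\<close> is restricted to fields, and the dual
  complex numbers have zero divisors.
\<close>

definition conj_transpose :: "dual_complex mat \<Rightarrow> dual_complex mat" where
  "conj_transpose A = map_mat conjugate (transpose_mat A)"

definition unitary_dc :: "dual_complex mat \<Rightarrow> bool" where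
  "unitary_dc U \<longleftrightarrow> square_mat U \<and>
     conj_transpose U * U = 1\<^sub>m (dim_row U) \<and> U * conj_transpose U = 1\<^sub>m (dim_row U)"

text \<open>
  \<open>is_svd A U S1 S2 V\<close>: \<open>A = U diag(S1, S2) V\<^sup>*\<close> is a singular value decomposition;
  the number of appreciable singular values is \<^term>\<open>dim_row S1\<close>. The diagonal entries
  are not required to be sorted.
\<close>

definition is_svd ::
  "dual_complex mat \<Rightarrow> dual_complex mat \<Rightarrow> dual_complex mat \<Rightarrow> dual_complex mat \<Rightarrow>
   dual_complex mat \<Rightarrow> bool" where
  "is_svd A U S1 S2 V \<longleftrightarrow>
     (\<exists>m n r. r \<le> m \<and> r \<le> n \<and>
        A \<in> carrier_mat m n \<and> U \<in> carrier_mat m m \<and> V \<in> carrier_mat n n \<and>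
        S1 \<in> carrier_mat r r \<and> S2 \<in> carrier_mat (m - r) (n - r) \<and>
        unitary_dc U \<and> unitary_dc V \<and>
        diagonal_mat S1 \<and> (\<forall>i<r. positive_appreciable (S1 $$ (i, i))) \<and>
        diagonal_mat S2 \<and>
        (\<forall>i<min (m - r) (n - r). positive_infinitesimal (S2 $$ (i, i)) \<or> S2 $$ (i, i) = 0) \<and>
        A = U * four_block_mat S1 (0\<^sub>m r (n - r)) (0\<^sub>m (m - r) r) S2 * conj_transpose V)"

text \<open>The essential part does not depend on the choice of the decomposition.\<close>

definition essential_part :: "dual_complex mat \<Rightarrow> dual_complex mat" where
  "essential_part A = (THE E. \<exists>U S1 S2 V. is_svd A U S1 S2 V \<and>
     (let m = dim_row A; n = dim_col A; r = dim_row S1 in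
      E = U * four_block_mat S1 (0\<^sub>m r (n - r)) (0\<^sub>m (m - r) r) (0\<^sub>m (m - r) (n - r))
            * conj_transpose V))"

definition is_ndmpi :: "dual_complex mat \<Rightarrow> dual_complex mat \<Rightarrow> bool" where
  "is_ndmpi A X \<longleftrightarrow>
     X \<in> carrier_mat (dim_col A) (dim_row A) \<and>
     A * X * A = essential_part A \<and>
     X * A * X = X \<and>
     conj_transpose (A * X) = A * X \<and>
     conj_transpose (X * A) = X * A"

definition ndmpi :: "dual_complex mat \<Rightarrow> dual_complex mat" where
  "ndmpi A = (THE X. is_ndmpi A X)"

end

theory Submission
  imports Defs "Jordan_Normal_Form.Spectral_Radius"
begin

text \<open>
  Call \<open>X\<close> a pseudoinverse of \<open>A\<close> if \<open>X A X = X\<close>, both \<open>A X\<close> and \<open>X A\<close> are Hermitian, and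
  \<open>A X A\<close> has the same standard part as \<open>A\<close>. Such an \<open>X\<close> is unique, because a product of two
  infinitesimal matrices vanishes, and a singular value decomposition provides one with
  \<open>A X A\<close> equal to the essential part; hence it is the new dual Moore-Penrose inverse.
  With \<open>P = A\<^sup>N A\<close> and \<open>Q = B B\<^sup>N\<close>, the hypothesis says that \<open>P\<close> commutes with \<open>B B\<^sup>*\<close> and
  \<open>Q\<close> with \<open>A\<^sup>* A\<close>. Therefore \<open>P\<close> and \<open>Q\<close> commute, and \<open>B\<^sup>N A\<^sup>N\<close> is a pseudoinverse of \<open>A B\<close>.

  The singular value decomposition is obtained by deflation at dual singular triples as long as
  the standard part is nonzero; the infinitesimal remainder is diagonalised by the singular
  value decomposition of a complex matrix.
\<close>

section \<open>Conjugate transposes and dual complex matrices\<close>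

text \<open>Both \<open>ndmpi\<close> and \<open>essential_part\<close> are definite descriptions,
  so they carry information only once a decomposition is known to exist and its essential part is
  known to be independent of the choice. The obstacle in the algebra is that
  \<open>A * X * A = A\<close> may fail for dual matrices, and the essential part of a product
  cannot simply be read off from its factors. Asking only for equal standard parts makes the reverse
  order law checkable: \<open>A * B * (Y * Z) * (A * B)\<close> reduces to the product of the two
  essential parts, and its standard part is that of \<open>A * B\<close>. With
  \<open>S = B * adj B\<close> and \<open>T = adj A * A\<close> the hypothesis reads
  \<open>P * (S * T) * Q = S * T\<close>. Since \<open>P\<close> is idempotent,
  \<open>P * (S * T) = S * T\<close>. Multiplying by the group inverse of \<open>T\<close> leaves
  \<open>P * S * P = S * P\<close>; the left side is Hermitian, so \<open>P\<close> and
  \<open>S\<close> commute. The same reasoning from the other side gives that \<open>Q\<close> and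
  \<open>T\<close> commute.\<close>

definition adj :: "'a::conjugatable_ring mat \<Rightarrow> 'a mat" where
  "adj A = map_mat conjugate (transpose_mat A)"

text \<open>The operation \<open>adj\<close> is polymorphic, so that one set of rules serves dual
  matrices as well as their complex standard and infinitesimal parts.\<close>

lemma conj_transpose_eq_adj: "conj_transpose = adj"
  by (rule ext) (simp add: conj_transpose_def adj_def)

lemma adj_dim [simp]: "dim_row (adj A) = dim_col A" "dim_col (adj A) = dim_row A"
  by (simp_all add: adj_def)

lemma adj_carrier [simp]: "A \<in> carrier_mat m n \<Longrightarrow> adj A \<in> carrier_mat n m"
  by (auto simp: adj_def)

lemma adj_index [simp]: "i < dim_col A \<Longrightarrow> j < dim_row A \<Longrightarrow> adj A $$ (i, j) = conjugate (A $$ (j, i))"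
  by (simp add: adj_def)

lemma adj_adj [simp]: "adj (adj A) = A"
  by (rule eq_matI) auto

lemma conjugate_one [simp]: "conjugate (1::'a::{conjugatable_ring,comm_ring_1}) = 1"
  using conjugate_dist_mul[of 1 "conjugate 1 :: 'a"] by simp

lemma adj_one [simp]: "adj (1\<^sub>m n :: 'a::{conjugatable_ring,comm_ring_1} mat) = 1\<^sub>m n"
  by (rule eq_matI) auto

lemma adj_zero [simp]: "adj (0\<^sub>m m n) = 0\<^sub>m n m"
  by (rule eq_matI) auto

lemma adj_mult [simp]:
  fixes A B :: "'a::{conjugatable_ring,comm_ring_1} mat"
  assumes "dim_col A = dim_row B"
  shows "adj (A * B) = adj B * adj A"
  using assms
  by (intro eq_matI)
     (auto simp: scalar_prod_def sum_conjugate conjugate_dist_mul mult.commute intro!: sum.cong)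

lemma conjugate_minus: "conjugate (a - b :: 'a::conjugatable_ring) = conjugate a - conjugate b"
  by (simp only: diff_conv_add_uminus conjugate_dist_add conjugate_neg)

lemma adj_minus [simp]:
  fixes A B :: "'a::{conjugatable_ring,comm_ring_1} mat"
  assumes "dim_row A = dim_row B" "dim_col A = dim_col B"
  shows "adj (A - B) = adj A - adj B"
  using assms
  by (intro eq_matI) (auto simp: conjugate_minus)

lemma adj_smult [simp]: "adj (c \<cdot>\<^sub>m A) = conjugate c \<cdot>\<^sub>m adj A"
  by (rule eq_matI) (auto simp: conjugate_dist_mul)

lemma adj_four_block:
  assumes "A \<in> carrier_mat m1 n1" "B \<in> carrier_mat m1 n2" "C \<in> carrier_mat m2 n1" "D \<in> carrier_mat m2 n2"
  shows "adj (four_block_mat A B C D) = four_block_mat (adj A) (adj C) (adj B) (adj D)"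
  using assms by (intro eq_matI) auto

lemma mat_assoc:
  fixes A B C :: "'a::semiring_0 mat"
  assumes "dim_col A = dim_row B" "dim_col B = dim_row C"
  shows "A * B * C = A * (B * C)"
  by (rule assoc_mult_mat) (use assms in auto)

declare assoc_mult_mat [simp del] carrier_matD [simp del]

text \<open>The classical argument: \<open>X * C\<close> is the product of the Hermitian matrices
  \<open>X * C\<close> and \<open>Y * C\<close>; taking adjoints swaps them, and
  \<open>C * X * C = C\<close> then removes \<open>X\<close>. It is applied to standard parts, where
  this equation holds exactly.\<close>

lemma penrose_unique:
  fixes C X Y :: "'a::{conjugatable_ring,comm_ring_1} mat"
  assumes X: "X \<in> carrier_mat (dim_col C) (dim_row C)" and Y: "Y \<in> carrier_mat (dim_col C) (dim_row C)"
    and CXC: "C * X * C = C" and XCX: "X * C * X = X"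
    and CX: "adj (C * X) = C * X" and XC: "adj (X * C) = X * C"
    and CYC: "C * Y * C = C" and YCY: "Y * C * Y = Y"
    and CY: "adj (C * Y) = C * Y" and YC: "adj (Y * C) = Y * C"
  shows "X = Y"
proof -
  note d [simp] = carrier_matD[OF X] carrier_matD[OF Y]
  have "X * C = X * (C * Y * C)" by (simp add: CYC)
  also have "\<dots> = (X * C) * (Y * C)" by (simp add: mat_assoc)
  finally have "adj (X * C) = adj ((X * C) * (Y * C))" by simp
  also have "\<dots> = adj (Y * C) * adj (X * C)" by (rule adj_mult) simp
  also have "\<dots> = Y * C * (X * C)" by (simp only: XC YC)
  also have "\<dots> = Y * (C * X * C)" by (simp add: mat_assoc)
  finally have 1: "X * C = Y * C" by (simp only: XC CXC)
  have "C * X = (C * Y * C) * X" by (simp add: CYC)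
  also have "\<dots> = (C * Y) * (C * X)" by (simp add: mat_assoc)
  finally have "adj (C * X) = adj ((C * Y) * (C * X))" by simp
  also have "\<dots> = adj (C * X) * adj (C * Y)" by (rule adj_mult) simp
  also have "\<dots> = C * X * (C * Y)" by (simp only: CX CY)
  also have "\<dots> = (C * X * C) * Y" by (simp add: mat_assoc)
  finally have 2: "C * X = C * Y" by (simp only: CX CXC)
  have "X = X * C * X" by (simp add: XCX)
  also have "\<dots> = Y * C * X" by (simp only: 1)
  also have "\<dots> = Y * (C * X)" by (simp add: mat_assoc)
  also have "\<dots> = Y * (C * Y)" by (simp only: 2)
  also have "\<dots> = Y * C * Y" by (simp add: mat_assoc)
  finally show ?thesis by (simp add: YCY)
qed

section \<open>Standard and infinitesimal parts of dual matrices\<close>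

lemma dual_complex_simps [simp]:
  "std_part 0 = 0" "inf_part 0 = 0" "std_part 1 = 1" "inf_part 1 = 0"
  "std_part (x + y) = std_part x + std_part y" "inf_part (x + y) = inf_part x + inf_part y"
  "std_part (x - y) = std_part x - std_part y" "inf_part (x - y) = inf_part x - inf_part y"
  "std_part (- x) = - std_part x" "inf_part (- x) = - inf_part x"
  "std_part (x * y) = std_part x * std_part y"
  "inf_part (x * y) = std_part x * inf_part y + inf_part x * std_part y"
  "std_part (conjugate x) = cnj (std_part x)" "inf_part (conjugate x) = cnj (inf_part x)"
  by (simp_all add: zero_dual_complex_def one_dual_complex_def plus_dual_complex_def
      uminus_dual_complex_def minus_dual_complex_def times_dual_complex_def conjugate_dual_complex_def)

lemma dual_complex_eqI: "std_part x = std_part y \<Longrightarrow> inf_part x = inf_part y \<Longrightarrow> x = y"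
  by (simp add: dual_complex.expand)

lemma std_part_sum [simp]: "std_part (sum f S) = (\<Sum>i\<in>S. std_part (f i))"
  by (induction S rule: infinite_finite_induct) auto

lemma inf_part_sum [simp]: "inf_part (sum f S) = (\<Sum>i\<in>S. inf_part (f i))"
  by (induction S rule: infinite_finite_induct) auto

abbreviation std_mat :: "dual_complex mat \<Rightarrow> complex mat" where
  "std_mat \<equiv> map_mat std_part"

abbreviation inf_mat :: "dual_complex mat \<Rightarrow> complex mat" where
  "inf_mat \<equiv> map_mat inf_part"

lemma dual_mat_eqI: "std_mat A = std_mat B \<Longrightarrow> inf_mat A = inf_mat B \<Longrightarrow> A = B"
  by (intro eq_matI dual_complex_eqI) (metis index_map_mat)+

lemma std_mat_mult [simp]: "dim_col A = dim_row B \<Longrightarrow> std_mat (A * B) = std_mat A * std_mat B"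
  by (intro eq_matI) (auto simp: scalar_prod_def)

lemma inf_mat_mult [simp]:
  "dim_col A = dim_row B \<Longrightarrow> inf_mat (A * B) = std_mat A * inf_mat B + inf_mat A * std_mat B"
  by (intro eq_matI) (auto simp: scalar_prod_def sum.distrib)

lemma std_mat_adj [simp]: "std_mat (adj A) = adj (std_mat A)"
  by (intro eq_matI) auto

lemma inf_mat_adj [simp]: "inf_mat (adj A) = adj (inf_mat A)"
  by (intro eq_matI) auto

lemma std_mat_minus [simp]:
  "dim_row A = dim_row B \<Longrightarrow> dim_col A = dim_col B \<Longrightarrow> std_mat (A - B) = std_mat A - std_mat B"
  by (intro eq_matI) auto

text \<open>Each summand of the infinitesimal part of a product contains the standard part of one
  factor.\<close>

lemma infinitesimal_mult:
  assumes "dim_col A = dim_row B" "std_mat A = 0\<^sub>m m q" "std_mat B = 0\<^sub>m q' n"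
  shows "A * B = 0\<^sub>m (dim_row A) (dim_col B)"
proof (rule dual_mat_eqI)
  have d: "dim_row A = m" "dim_col A = q" "dim_row B = q'" "dim_col B = n"
    using assms(2,3) by (metis index_map_mat index_zero_mat)+
  have [simp]: "inf_mat A \<in> carrier_mat m q" "inf_mat B \<in> carrier_mat q n" using d assms(1) by auto
  show "std_mat (A * B) = std_mat (0\<^sub>m (dim_row A) (dim_col B))"
    using assms d by (auto intro!: eq_matI)
  show "inf_mat (A * B) = inf_mat (0\<^sub>m (dim_row A) (dim_col B))"
    using assms(1) d unfolding inf_mat_mult[OF assms(1)] assms(2,3) by (auto intro!: eq_matI)
qed

text \<open>The essential part does not occur here; \<open>ndmpi_eq\<close> shows that these conditions
  nevertheless single out the new dual Moore-Penrose inverse.\<close>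

definition dual_pinv :: "dual_complex mat \<Rightarrow> dual_complex mat \<Rightarrow> bool" where
  "dual_pinv C X \<longleftrightarrow> X \<in> carrier_mat (dim_col C) (dim_row C) \<and>
     std_mat (C * X * C) = std_mat C \<and> X * C * X = X \<and>
     adj (C * X) = C * X \<and> adj (X * C) = X * C"

lemma dual_pinvD:
  assumes "dual_pinv C X"
  shows "dim_row X = dim_col C" "dim_col X = dim_row C" "std_mat (C * X * C) = std_mat C"
    "X * C * X = X" "adj (C * X) = C * X" "adj (X * C) = X * C"
  using assms by (auto simp: dual_pinv_def)

section \<open>Uniqueness of the pseudoinverse of a dual matrix\<close>

lemma mat_eq_if_diff_zero:
  fixes A B :: "'a::ab_group_add mat"
  assumes "A - B = 0\<^sub>m m n" "dim_row A = dim_row B" "dim_col A = dim_col B"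
  shows "A = B"
proof (rule eq_matI)
  fix i j assume ij: "i < dim_row B" "j < dim_col B"
  have d: "dim_row B = m" "dim_col B = n" using assms(1) by (metis index_minus_mat(2,3) index_zero_mat(2,3))+
  have "(A - B) $$ (i, j) = 0" using ij d assms(1) by simp
  then show "A $$ (i, j) = B $$ (i, j)" using ij by simp
qed (use assms in auto)

lemma mat_mult_minus_right:
  fixes A B C :: "'a::ring mat"
  assumes "dim_col A = dim_row B" "dim_row B = dim_row C" "dim_col B = dim_col C"
  shows "A * (B - C) = A * B - A * C"
  by (rule mult_minus_distrib_mat) (use assms in auto)

lemma mat_mult_minus_left:
  fixes A B C :: "'a::ring mat"
  assumes "dim_col A = dim_row C" "dim_row A = dim_row B" "dim_col A = dim_col B"
  shows "(A - B) * C = A * C - B * C"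
  by (rule minus_mult_distrib_mat) (use assms in auto)

text \<open>Transfers facts about \<open>X * C\<close> to \<open>C * X\<close>, and facts about
  \<open>B * adj B\<close> to \<open>adj A * A\<close>.\<close>

lemma dual_pinv_adj:
  assumes "dual_pinv C X"
  shows "dual_pinv (adj C) (adj X)"
proof -
  note [simp] = dual_pinvD(1,2)[OF assms]
  have 1: "adj C * adj X * adj C = adj (C * X * C)" "adj X * adj C * adj X = adj (X * C * X)"
    "adj C * adj X = adj (X * C)" "adj X * adj C = adj (C * X)"
    by (simp_all add: mat_assoc)
  show ?thesis
    unfolding dual_pinv_def
  proof (intro conjI)
    show "std_mat (adj C * adj X * adj C) = std_mat (adj C)"
      unfolding 1(1) std_mat_adj by (simp only: dual_pinvD(3)[OF assms])
    show "adj X * adj C * adj X = adj X"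
      unfolding 1(2) by (simp only: dual_pinvD(4)[OF assms])
    show "adj (adj C * adj X) = adj C * adj X" "adj (adj X * adj C) = adj X * adj C"
      unfolding 1(3,4) by (simp_all only: dual_pinvD(5,6)[OF assms])
    have a: "dim_row (adj X) = dim_col (adj C)" "dim_col (adj X) = dim_row (adj C)"
      unfolding adj_dim by (rule dual_pinvD[OF assms])+
    show "adj X \<in> carrier_mat (dim_col (adj C)) (dim_row (adj C))"
      using a by (rule carrier_matI)
  qed
qed

text \<open>On standard parts the defect of \<open>C * X * C\<close> disappears and the four Penrose
  equations remain.\<close>

lemma dual_pinv_std_unique:
  assumes "dual_pinv C X" "dual_pinv C Y"
  shows "std_mat X = std_mat Y"
proof -
  note [simp] = dual_pinvD(1,2)[OF assms(1)] dual_pinvD(1,2)[OF assms(2)]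
  have *: "std_mat C * std_mat Z * std_mat C = std_mat C" "std_mat Z * std_mat C * std_mat Z = std_mat Z"
    "adj (std_mat C * std_mat Z) = std_mat C * std_mat Z" "adj (std_mat Z * std_mat C) = std_mat Z * std_mat C"
    if Z: "dual_pinv C Z" for Z
  proof -
    note [simp] = dual_pinvD(1,2)[OF Z]
    have "std_mat (Z * C * Z) = std_mat Z" "std_mat (adj (C * Z)) = std_mat (C * Z)"
      "std_mat (adj (Z * C)) = std_mat (Z * C)"
      using dual_pinvD[OF Z] by simp_all
    with dual_pinvD(3)[OF Z]
    show "std_mat C * std_mat Z * std_mat C = std_mat C" "std_mat Z * std_mat C * std_mat Z = std_mat Z"
      "adj (std_mat C * std_mat Z) = std_mat C * std_mat Z" "adj (std_mat Z * std_mat C) = std_mat Z * std_mat C"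
      unfolding std_mat_adj by (simp_all add: mat_assoc)
  qed
  show ?thesis
    by (rule penrose_unique[of _ "std_mat C"]) (use *[OF assms(1)] *[OF assms(2)] in auto)
qed

text \<open>The factors \<open>Y - X\<close> and \<open>C - C X C\<close> are both infinitesimal, so their product vanishes.\<close>

lemma dual_pinv_left_absorb:
  assumes "dual_pinv C X" "dual_pinv C Y"
  shows "Y * C = Y * C * (X * C)"
proof -
  note d [simp] = dual_pinvD(1,2)[OF assms(1)] dual_pinvD(1,2)[OF assms(2)]
  let ?G = "C - C * X * C"
  have "std_mat (Y - X) = 0\<^sub>m (dim_col C) (dim_row C)"
    using dual_pinv_std_unique[OF assms] by (auto intro!: eq_matI)
  moreover have "std_mat ?G = 0\<^sub>m (dim_row C) (dim_col C)"
    using dual_pinvD(3)[OF assms(1)] by (simp del: std_mat_mult)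
  ultimately have "(Y - X) * ?G = 0\<^sub>m (dim_col C) (dim_col C)"
    by (subst infinitesimal_mult) auto
  then have "Y * ?G - X * ?G = 0\<^sub>m (dim_col C) (dim_col C)"
    by (simp add: mat_mult_minus_left)
  then have "Y * ?G = X * ?G" by (rule mat_eq_if_diff_zero) auto
  also have "\<dots> = X * C - X * C * X * C" by (simp add: mat_mult_minus_right mat_assoc)
  also have "\<dots> = X * C - X * C" by (simp only: dual_pinvD(4)[OF assms(1)])
  finally have "Y * C - Y * C * (X * C) = 0\<^sub>m (dim_col C) (dim_col C)"
    by (auto simp: mat_mult_minus_right mat_assoc)
  then show ?thesis by (rule mat_eq_if_diff_zero) auto
qed

text \<open>Each of the projectors \<open>X * C\<close> and \<open>Y * C\<close> absorbs the other
  on its right. Both are Hermitian, so the adjoint of one absorption meets the other.\<close>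

lemma dual_pinv_left_unique:
  assumes "dual_pinv C X" "dual_pinv C Y"
  shows "X * C = Y * C"
proof -
  note d [simp] = dual_pinvD(1,2)[OF assms(1)] dual_pinvD(1,2)[OF assms(2)]
  have "adj (Y * C) = adj (Y * C * (X * C))" using dual_pinv_left_absorb[OF assms] by simp
  also have "\<dots> = adj (X * C) * adj (Y * C)" by (rule adj_mult) simp
  also have "\<dots> = X * C * (Y * C)" by (simp only: dual_pinvD(6)[OF assms(1)] dual_pinvD(6)[OF assms(2)])
  also have "\<dots> = X * C" using dual_pinv_left_absorb[OF assms(2,1)] by simp
  finally show ?thesis by (simp only: dual_pinvD(6)[OF assms(2)])
qed

lemma dual_pinv_unique:
  assumes "dual_pinv C X" "dual_pinv C Y"
  shows "X = Y"
proof -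
  note d [simp] = dual_pinvD(1,2)[OF assms(1)] dual_pinvD(1,2)[OF assms(2)]
  have "adj X * adj C = adj Y * adj C"
    by (rule dual_pinv_left_unique) (intro dual_pinv_adj assms)+
  then have "adj (C * X) = adj (C * Y)" by simp
  then have 1: "C * X = C * Y" by (metis adj_adj)
  have "X = X * C * X" by (simp only: dual_pinvD[OF assms(1)])
  also have "\<dots> = Y * C * X" by (simp only: dual_pinv_left_unique[OF assms])
  also have "\<dots> = Y * (C * X)" by (simp add: mat_assoc)
  also have "\<dots> = Y * C * Y" by (simp add: 1 mat_assoc)
  finally show ?thesis by (simp only: dual_pinvD[OF assms(2)])
qed

section \<open>The reverse order law for pseudoinverses\<close>

text \<open>As \<open>B - B Y B\<close> is infinitesimal, its square norm vanishes, so only the essential part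
  of \<open>B\<close> enters \<open>B B\<^sup>*\<close>.\<close>

lemma dual_pinv_gram_absorb:
  assumes Y: "dual_pinv B Y"
  shows "B * Y * (B * adj B) = B * adj B"
proof -
  note [simp] = dual_pinvD(1,2)[OF Y]
  let ?G = "B - B * Y * B"
  have "std_mat ?G = 0\<^sub>m (dim_row B) (dim_col B)"
    using dual_pinvD(3)[OF Y] by (simp del: std_mat_mult)
  moreover have "std_mat (adj ?G) = 0\<^sub>m (dim_col B) (dim_row B)"
    unfolding std_mat_adj calculation by simp
  ultimately have 1: "?G * adj ?G = 0\<^sub>m (dim_row B) (dim_row B)"
    by (subst infinitesimal_mult) auto
  have "?G * (Y * B) = B * (Y * B) - B * (Y * B * Y * B)"
    by (simp add: mat_mult_minus_left mat_assoc)
  \<comment> \<open>The defect annihilates the projector \<open>Y * B\<close>, so the term with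
    \<open>B * Y * B\<close> drops out of the vanishing product of the defect with its adjoint, and
    only the term with \<open>adj B\<close> remains.\<close>
  then have G0: "?G * (Y * B) = 0\<^sub>m (dim_row B) (dim_col B)"
    unfolding dual_pinvD(4)[OF Y] by (auto intro!: eq_matI)
  have "adj (B * Y * B) = adj (Y * B) * adj B" by (simp add: mat_assoc)
  also have "\<dots> = Y * B * adj B" by (simp only: dual_pinvD(6)[OF Y])
  finally have "?G * adj (B * Y * B) = ?G * (Y * B) * adj B" by (simp add: mat_assoc)
  also have "\<dots> = 0\<^sub>m (dim_row B) (dim_row B)" unfolding G0 by (rule left_mult_zero_mat) auto
  finally have 2: "?G * adj (B * Y * B) = 0\<^sub>m (dim_row B) (dim_row B)" .
  have "adj ?G = adj B - adj (B * Y * B)" by (rule adj_minus) auto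
  then have "?G * adj ?G = ?G * adj B - ?G * adj (B * Y * B)"
    by (simp add: mat_mult_minus_right del: adj_mult adj_minus)
  then have "?G * adj B = 0\<^sub>m (dim_row B) (dim_row B)" unfolding 1 2
    by (rule mat_eq_if_diff_zero[OF sym]) simp_all
  then have "B * adj B - B * Y * (B * adj B) = 0\<^sub>m (dim_row B) (dim_row B)"
    by (simp add: mat_mult_minus_left mat_assoc)
  then show ?thesis by (rule mat_eq_if_diff_zero[symmetric]) simp_all
qed

text \<open>The inner factors form the adjoint of the Hermitian \<open>Y * B\<close>, and
  \<open>Y * B * Y = Y\<close> collapses the rest.\<close>

lemma dual_pinv_gram_inverse:
  assumes Y: "dual_pinv B Y"
  shows "B * adj B * (adj Y * Y) = B * Y" "adj Y * Y * (B * adj B) = B * Y"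
proof -
  note [simp] = dual_pinvD(1,2)[OF Y]
  have "B * adj B * (adj Y * Y) = B * adj (Y * B) * Y" by (simp add: mat_assoc)
  also have "\<dots> = B * (Y * B * Y)" by (simp only: dual_pinvD(6)[OF Y]) (simp add: mat_assoc)
  finally show 1: "B * adj B * (adj Y * Y) = B * Y" by (simp only: dual_pinvD(4)[OF Y])
  have "adj Y * Y * (B * adj B) = adj (B * adj B * (adj Y * Y))" by (simp add: mat_assoc)
  then show "adj Y * Y * (B * adj B) = B * Y" by (simp only: 1 dual_pinvD(5)[OF Y])
qed

text \<open>\<open>Y\<^sup>* Y\<close> acts as a group inverse of \<open>B B\<^sup>*\<close>, hence commutes with everything that commutes with \<open>B B\<^sup>*\<close>.\<close>

lemma dual_pinv_commute:
  assumes Y: "dual_pinv B Y" and P: "P \<in> carrier_mat (dim_row B) (dim_row B)" and aP: "adj P = P"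
    and c: "P * (B * adj B) = B * adj B * P"
  shows "P * (B * Y) = B * Y * P" "P * (adj Y * Y) = adj Y * Y * P"
proof -
  note [simp] = dual_pinvD(1,2)[OF Y] carrier_matD[OF P]
  define S where "S = B * adj B"
  define R where "R = adj Y * Y"
  define Q where "Q = B * Y"
  have [simp]: "dim_row S = dim_row B" "dim_col S = dim_row B" "dim_row R = dim_row B" "dim_col R = dim_row B"
     "dim_row Q = dim_row B" "dim_col Q = dim_row B"
    by (simp_all add: S_def R_def Q_def)
  have SR: "S * R = Q" "R * S = Q" and QS: "Q * S = S" and aQ: "adj Q = Q" and c: "P * S = S * P"
    using dual_pinv_gram_inverse[OF Y] dual_pinv_gram_absorb[OF Y] dual_pinvD(5)[OF Y] c
    by (simp_all add: S_def R_def Q_def del: adj_mult)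
  have QR: "R * Q = R" "Q * R = R"
  proof -
    have "R * Q = adj Y * (Y * B * Y)" by (simp add: R_def Q_def mat_assoc)
    then show 1: "R * Q = R" by (simp only: dual_pinvD(4)[OF Y] R_def)
    have "adj (R * Q) = adj Q * adj R" by simp
    then show "Q * R = R" unfolding aQ 1 by (simp add: R_def)
  qed
  \<comment> \<open>\<open>Q = S * R\<close> lets \<open>P\<close> pass \<open>S\<close>, and
    \<open>S = Q * S\<close> then produces a factor \<open>Q\<close> on the left. The result
    \<open>Q * P * Q\<close> is Hermitian, so \<open>P * Q\<close> equals its adjoint
    \<open>Q * P\<close>.\<close>
  have "P * Q = S * P * R" by (simp add: SR(1)[symmetric] c mat_assoc[symmetric])
  also have "\<dots> = Q * (P * S) * R" by (simp add: QS c mat_assoc[symmetric])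
  also have "\<dots> = Q * P * Q" by (simp add: SR(1)[symmetric] mat_assoc)
  finally have PQ: "P * Q = Q * P * Q" .
  have "adj (P * Q) = Q * P" "adj (Q * P * Q) = Q * P * Q" by (simp_all add: aP aQ mat_assoc)
  with PQ have com: "P * Q = Q * P" by simp
  \<comment> \<open>A factor \<open>Q\<close> is split off from \<open>R\<close>, moved across
    \<open>P\<close> and expanded to \<open>S * R\<close>; now \<open>P\<close> can pass
    \<open>S\<close>, and \<open>R * S\<close> is a projector again.\<close>
  have "R * P = R * (Q * P)" by (simp add: mat_assoc[symmetric] QR)
  also have "\<dots> = R * (P * S) * R" by (simp only: com[symmetric]) (simp add: SR(1)[symmetric] mat_assoc)
  also have "\<dots> = Q * P * R" by (simp add: c mat_assoc[symmetric] SR)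
  also have "\<dots> = P * R" by (simp add: com[symmetric] mat_assoc QR)
  finally show "P * (adj Y * Y) = adj Y * Y * P" by (simp add: R_def)
  show "P * (B * Y) = B * Y * P" using com by (simp add: Q_def)
qed

text \<open>Commutation of \<open>P\<close> with \<open>Q\<close> gives the two conditions on triple
  products; commutation of \<open>P\<close> with \<open>adj Y * Y\<close> and of \<open>Q\<close>
  with \<open>Z * adj Z\<close> gives the two Hermitian conditions.\<close>

lemma dual_pinv_mult:
  assumes A: "A \<in> carrier_mat m q" and B: "B \<in> carrier_mat q n"
    and Z: "dual_pinv A Z" and Y: "dual_pinv B Y"
    and hyp: "Z * A * B * adj B * adj A * A * B * Y = B * adj B * adj A * A"
  shows "dual_pinv (A * B) (Y * Z)"
proof -
  note [simp] = carrier_matD[OF A] carrier_matD[OF B]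
  note [simp] = dual_pinvD(1,2)[OF Y] dual_pinvD(1,2)[OF Z]
  define S where "S = B * adj B"
  define T where "T = adj A * A"
  define P where "P = Z * A"
  define Q where "Q = B * Y"
  have [simp]: "dim_row S = q" "dim_col S = q" "dim_row T = q" "dim_col T = q"
     "dim_row Q = q" "dim_col Q = q" "dim_row P = q" "dim_col P = q"
    by (simp_all add: S_def T_def P_def Q_def)
  have aP: "adj P = P" and aQ: "adj Q = Q" and aS: "adj S = S" and aT: "adj T = T"
    using dual_pinvD(6)[OF Z] dual_pinvD(5)[OF Y] by (simp_all add: P_def Q_def S_def T_def)
  have PP: "P * P = P" and QQ: "Q * Q = Q"
  proof -
    have "P * P = Z * A * Z * A" "Q * Q = B * (Y * B * Y)" by (simp_all add: P_def Q_def mat_assoc)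
    then show "P * P = P" "Q * Q = Q"
      by (simp_all only: dual_pinvD(4)[OF Z] dual_pinvD(4)[OF Y] P_def Q_def)
  qed
  have hyp: "P * (S * T) * Q = S * T"
    using hyp by (simp add: P_def Q_def S_def T_def mat_assoc)
  have PST: "P * (S * T) = S * T"
  proof -
    have "P * (S * T) = P * (P * (S * T) * Q)" by (simp only: hyp)
    also have "\<dots> = P * P * (S * T) * Q" by (simp add: mat_assoc)
    finally show ?thesis by (simp only: PP hyp)
  qed
  have STQ: "S * T * Q = S * T"
    using hyp by (simp only: PST)
  note aZ = dual_pinv_adj[OF Z]
  \<comment> \<open>Taken at \<open>adj A\<close> and \<open>adj Z\<close>, so the Gram matrix is
    \<open>T\<close> and its group inverse is \<open>Z * adj Z\<close>.\<close>
  note TT = dual_pinv_gram_inverse[OF aZ, unfolded adj_adj]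
  have AZ: "adj A * adj Z = P" using aP by (simp add: P_def)
  have PSP: "P * S * P = S * P"
  proof -
    have "P * S * P = P * (S * T) * (Z * adj Z)"
      by (simp add: AZ[symmetric] TT(1)[symmetric] T_def mat_assoc)
    also have "\<dots> = S * P" by (simp only: PST) (simp add: AZ[symmetric] TT(1)[symmetric] T_def mat_assoc)
    finally show ?thesis .
  qed
  have PS: "P * S = S * P"
  proof -
    have "adj (P * S * P) = P * S * P" by (simp add: aP aS mat_assoc)
    then show ?thesis unfolding PSP by (simp add: aP aS)
  qed
  note SS = dual_pinv_gram_inverse[OF Y]
  \<comment> \<open>Here \<open>S\<close> is cancelled on the left, where above \<open>T\<close> was
    cancelled on the right.\<close>
  have QTQ: "Q * T * Q = Q * T"
  proof -
    have RS: "adj Y * Y * S = Q" by (simp only: SS(2) S_def Q_def)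
    have "Q * T * Q = adj Y * Y * (S * T * Q)" by (simp add: RS[symmetric] mat_assoc)
    also have "\<dots> = Q * T" by (simp only: STQ) (simp add: RS[symmetric] mat_assoc)
    finally show ?thesis .
  qed
  have QT: "Q * T = T * Q"
  proof -
    have "adj (Q * T * Q) = Q * T * Q" by (simp add: aQ aT mat_assoc)
    then show ?thesis unfolding QTQ by (simp add: aQ aT)
  qed
  have c1: "P * Q = Q * P" "P * (adj Y * Y) = adj Y * Y * P"
    using dual_pinv_commute[OF Y _ aP] PS by (simp_all add: Q_def S_def carrier_mat_def)
  have c2: "Q * (Z * adj Z) = Z * adj Z * Q"
    using dual_pinv_commute(2)[OF aZ _ aQ] QT by (simp_all add: T_def carrier_mat_def)
  have Y': "Y = adj B * (adj Y * Y)"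
  proof -
    have "adj B * (adj Y * Y) = adj (Y * B) * Y" by (simp add: mat_assoc)
    also have "\<dots> = Y" by (simp only: dual_pinvD(4,6)[OF Y])
    finally show ?thesis by simp
  qed
  have Z': "Z = Z * adj Z * adj A"
  proof -
    have "Z * adj Z * adj A = Z * adj (A * Z)" by (simp add: mat_assoc)
    also have "\<dots> = Z * A * Z" by (simp only: dual_pinvD(5)[OF Z]) (simp add: mat_assoc)
    finally show ?thesis by (simp only: dual_pinvD(4)[OF Z])
  qed
  \<comment> \<open>Expanding \<open>Z\<close> brings the product into the form
    \<open>A * N * adj A\<close>, which is Hermitian as soon as \<open>N = Q * (Z * adj Z)\<close>
    is.\<close>
  have "A * B * (Y * Z) = A * (Q * (Z * adj Z)) * adj A"
    by (subst Z') (simp add: Q_def mat_assoc)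
  moreover have "adj (A * (Q * (Z * adj Z)) * adj A) = A * (Z * adj Z * Q) * adj A"
    by (simp add: aQ mat_assoc)
  ultimately have 1: "adj (A * B * (Y * Z)) = A * B * (Y * Z)" by (simp only: c2)
  have "Y * Z * (A * B) = adj B * (adj Y * Y * P) * B"
    by (subst Y') (simp add: P_def mat_assoc)
  moreover have "adj (adj B * (adj Y * Y * P) * B) = adj B * (P * (adj Y * Y)) * B"
    by (simp add: aP mat_assoc)
  ultimately have 2: "adj (Y * Z * (A * B)) = Y * Z * (A * B)" by (simp only: c1)
  have "Y * Z * (A * B) * (Y * Z) = Y * (P * Q) * Z" by (simp add: P_def Q_def mat_assoc)
  also have "\<dots> = Y * B * Y * (Z * A * Z)" by (simp only: c1) (simp add: P_def Q_def mat_assoc)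
  finally have 3: "Y * Z * (A * B) * (Y * Z) = Y * Z" by (simp only: dual_pinvD(4)[OF Y] dual_pinvD(4)[OF Z])
  have "A * B * (Y * Z) * (A * B) = A * (Q * P) * B" by (simp add: P_def Q_def mat_assoc)
  also have "\<dots> = A * Z * A * (B * Y * B)" by (simp only: c1[symmetric]) (simp add: P_def Q_def mat_assoc)
  finally have "std_mat (A * B * (Y * Z) * (A * B)) = std_mat (A * Z * A) * std_mat (B * Y * B)"
    by (simp only:) (rule std_mat_mult, simp)
  also have "\<dots> = std_mat (A * B)" by (simp only: dual_pinvD(3)[OF Y] dual_pinvD(3)[OF Z]) simp
  finally show ?thesis unfolding dual_pinv_def using 1 2 3 by (simp add: carrier_mat_def)
qed

section \<open>Unitary matrices and deflation\<close>

definition unitary :: "nat \<Rightarrow> 'a::{conjugatable_ring,comm_ring_1} mat \<Rightarrow> bool" where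
  "unitary n U \<longleftrightarrow> U \<in> carrier_mat n n \<and> adj U * U = 1\<^sub>m n \<and> U * adj U = 1\<^sub>m n"

lemma unitaryD:
  assumes "unitary n U"
  shows "dim_row U = n" "dim_col U = n" "adj U * U = 1\<^sub>m n" "U * adj U = 1\<^sub>m n"
  using assms by (auto simp: unitary_def)

lemma unitary_one [simp]: "unitary n (1\<^sub>m n)"
  by (simp add: unitary_def)

lemma unitary_mult:
  assumes "unitary n U" "unitary n V"
  shows "unitary n (U * V)"
proof -
  note [simp] = unitaryD(1,2)[OF assms(1)] unitaryD(1,2)[OF assms(2)]
  have "adj (U * V) * (U * V) = adj V * (adj U * U) * V" by (simp add: mat_assoc)
  moreover have "U * V * adj (U * V) = U * (V * adj V) * adj U" by (simp add: mat_assoc)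
  ultimately show ?thesis
    unfolding unitary_def unitaryD(3,4)[OF assms(1)] unitaryD(3,4)[OF assms(2)]
    using unitaryD(3,4)[OF assms(1)] unitaryD(3,4)[OF assms(2)] by (simp add: carrier_mat_def)
qed

text \<open>Lets a unitary matrix found for a remaining block act without disturbing the
  \<open>k\<close> coordinates already treated.\<close>

definition block_ext :: "nat \<Rightarrow> 'a::{zero,one} mat \<Rightarrow> 'a mat" where
  "block_ext k U = four_block_mat (1\<^sub>m k) (0\<^sub>m k (dim_col U)) (0\<^sub>m (dim_row U) k) U"

lemma block_ext_dim [simp]: "dim_row (block_ext k U) = k + dim_row U" "dim_col (block_ext k U) = k + dim_col U"
  by (simp_all add: block_ext_def)

lemma adj_block_ext:
  "adj (block_ext k U :: 'a::{conjugatable_ring,comm_ring_1} mat) = block_ext k (adj U)"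
  unfolding block_ext_def by (subst adj_four_block[of _ k k _ "dim_col U" _ "dim_row U"]) auto

lemma four_block_diag_mult:
  fixes A1 A2 :: "'a::comm_ring_1 mat"
  assumes "A1 \<in> carrier_mat m1 k1" "D1 \<in> carrier_mat m2 k2" "A2 \<in> carrier_mat k1 n1" "D2 \<in> carrier_mat k2 n2"
  shows "four_block_mat A1 (0\<^sub>m m1 k2) (0\<^sub>m m2 k1) D1 * four_block_mat A2 (0\<^sub>m k1 n2) (0\<^sub>m k2 n1) D2 =
    four_block_mat (A1 * A2) (0\<^sub>m m1 n2) (0\<^sub>m m2 n1) (D1 * D2)"
  by (subst mult_four_block_mat[OF assms(1) _ _ assms(2) assms(3) _ _ assms(4)])
     (simp_all add: right_mult_zero_mat[OF assms(1)] right_mult_zero_mat[OF assms(2)]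
       left_mult_zero_mat[OF assms(3)] left_mult_zero_mat[OF assms(4)]
       right_add_zero_mat[OF mult_carrier_mat[OF assms(1,3)]] left_add_zero_mat[OF mult_carrier_mat[OF assms(2,4)]])

lemma unitary_block_ext:
  assumes "unitary n U"
  shows "unitary (k + n) (block_ext k U)"
proof -
  note u = unitaryD[OF assms]
  have c: "U \<in> carrier_mat n n" "adj U \<in> carrier_mat n n" using u by (auto simp: carrier_mat_def)
  have "adj (block_ext k U) * block_ext k U = 1\<^sub>m (k + n)"
    unfolding adj_block_ext unfolding block_ext_def adj_dim u(1,2)
    by (subst four_block_diag_mult[OF one_carrier_mat c(2) one_carrier_mat c(1)]) (simp add: u)
  moreover have "block_ext k U * adj (block_ext k U) = 1\<^sub>m (k + n)"
    unfolding adj_block_ext unfolding block_ext_def adj_dim u(1,2)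
    by (subst four_block_diag_mult[OF one_carrier_mat c(1) one_carrier_mat c(2)]) (simp add: u)
  ultimately show ?thesis by (simp add: unitary_def carrier_mat_def u)
qed

lemma block_ext_conj:
  fixes A :: "'a::{conjugatable_ring,comm_ring_1} mat"
  assumes A: "A \<in> carrier_mat r s" and D: "D \<in> carrier_mat m n"
    and U: "unitary m U" and V: "unitary n V" and rs: "r = s"
  shows "adj (block_ext r U) * four_block_mat A (0\<^sub>m r n) (0\<^sub>m m s) D * block_ext s V =
    four_block_mat A (0\<^sub>m r n) (0\<^sub>m m s) (adj U * D * V)"
proof -
  have c: "V \<in> carrier_mat n n" "adj U \<in> carrier_mat m m" "adj U * D \<in> carrier_mat m n"
    using unitaryD(1,2)[OF U] unitaryD(1,2)[OF V] D by (auto simp: carrier_mat_def)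
  show ?thesis
    unfolding adj_block_ext unfolding block_ext_def adj_dim unitaryD(1,2)[OF U] unitaryD(1,2)[OF V]
    apply (subst four_block_diag_mult[OF one_carrier_mat c(2) A D])
    apply (subst four_block_diag_mult[OF _ c(3) one_carrier_mat c(1)])
    using A by (auto simp: left_mult_one_mat right_mult_one_mat)
qed

text \<open>\<open>p (\<beta> w w\<^sup>* - 1)\<close> with \<open>w = v + p e\<^sub>1\<close> is, up to the phase \<open>p\<close> of the first entry
  \<open>p \<alpha>\<close> of \<open>v\<close>, the Householder reflection taking \<open>e\<^sub>1\<close> to \<open>v\<close>.\<close>

lemma unitary_completion:
  fixes v :: "'a::{conjugatable_ring,comm_ring_1} mat"
  assumes v: "v \<in> carrier_mat n 1" "adj v * v = 1\<^sub>m 1" and n: "n > 0"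
    and p: "p * conjugate p = 1" and a: "v $$ (0, 0) = p * \<alpha>" "conjugate \<alpha> = \<alpha>" and b: "(1 + \<alpha>) * \<beta> = 1"
  obtains U where "unitary n U" "\<And>i. i < n \<Longrightarrow> U $$ (i, 0) = v $$ (i, 0)"
proof -
  \<comment> \<open>The sign makes the divisor \<open>1 + \<alpha>\<close>; subtracting
    \<open>p\<close> instead would lead to \<open>1 - \<alpha>\<close>, which is 0 when
    \<open>v\<close> is \<open>p\<close> times the first unit vector.\<close>
  define w where "w i = v $$ (i, 0) + (if i = 0 then p else 0)" for i
  define H where "H = mat n n (\<lambda>(i, j). \<beta> * w i * conjugate (w j) - (if i = j then 1 else 0))"
  have d [simp]: "dim_row v = n" "dim_col v = 1" "dim_row H = n" "dim_col H = n"
    using v by (auto simp: H_def)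
  have cb: "conjugate \<beta> = \<beta>"
  proof -
    have "conjugate \<beta> = conjugate \<beta> * ((1 + \<alpha>) * \<beta>)" by (simp add: b)
    also have "\<dots> = conjugate ((1 + \<alpha>) * \<beta>) * \<beta>" by (simp add: conjugate_dist_mul conjugate_dist_add a)
    also have "\<dots> = \<beta>" by (simp add: b)
    finally show ?thesis .
  qed
  have v1: "(\<Sum>k<n. conjugate (v $$ (k, 0)) * v $$ (k, 0)) = 1"
    using arg_cong[OF v(2), of "\<lambda>M. M $$ (0, 0)"] by (simp add: scalar_prod_def atLeast0LessThan)
  have "(\<Sum>k<n. conjugate (w k) * w k) = (\<Sum>k<n. conjugate (v $$ (k, 0)) * v $$ (k, 0)
      + (if k = 0 then conjugate p * v $$ (0, 0) + p * conjugate (v $$ (0, 0)) + p * conjugate p else 0))"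
    by (intro sum.cong) (auto simp: w_def conjugate_dist_add algebra_simps)
  also have "\<dots> = 1 + (conjugate p * v $$ (0, 0) + p * conjugate (v $$ (0, 0)) + p * conjugate p)"
    using n by (simp add: sum.distrib v1)
  also have "\<dots> = 1 + (p * conjugate p * \<alpha> + p * conjugate p * \<alpha> + p * conjugate p)"
    by (simp add: a conjugate_dist_mul algebra_simps)
  \<comment> \<open>So \<beta> is 2 divided by the squared norm of \<open>w\<close>, the Householder
    coefficient that makes \<open>H\<close> an involution.\<close>
  finally have w2: "(\<Sum>k<n. conjugate (w k) * w k) = (1 + \<alpha>) + (1 + \<alpha>)" by (simp add: p)
  have aH: "adj H = H"
    by (rule eq_matI) (auto simp: H_def conjugate_dist_mul conjugate_minus cb mult_ac)
  have HH: "H * H = 1\<^sub>m n"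
  proof (rule eq_matI)
    fix i j assume "i < dim_row (1\<^sub>m n :: 'a mat)" "j < dim_col (1\<^sub>m n :: 'a mat)"
    then have ij: "i < n" "j < n" by auto
    have "(H * H) $$ (i, j) = (\<Sum>k<n. H $$ (i, k) * H $$ (k, j))"
      using ij by (simp add: scalar_prod_def atLeast0LessThan)
    also have "\<dots> = (\<Sum>k<n. \<beta> * \<beta> * w i * conjugate (w j) * (conjugate (w k) * w k)
        - (if k = i then \<beta> * w i * conjugate (w j) else 0)
        - (if k = j then \<beta> * w i * conjugate (w j) else 0) + (if k = i then if i = j then 1 else 0 else 0))"
      using ij by (intro sum.cong) (auto simp: H_def algebra_simps)
    also have "\<dots> = \<beta> * \<beta> * w i * conjugate (w j) * ((1 + \<alpha>) + (1 + \<alpha>))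
        - \<beta> * w i * conjugate (w j) - \<beta> * w i * conjugate (w j) + (if i = j then 1 else 0)"
      using ij by (simp add: sum.distrib sum_subtractf w2 flip: sum_distrib_left)
    also have "\<dots> = ((1 + \<alpha>) * \<beta>) * \<beta> * w i * conjugate (w j) + ((1 + \<alpha>) * \<beta>) * \<beta> * w i * conjugate (w j)
        - \<beta> * w i * conjugate (w j) - \<beta> * w i * conjugate (w j) + (if i = j then 1 else 0)"
      by (simp add: algebra_simps)
    also have "\<dots> = 1\<^sub>m n $$ (i, j)" using ij by (simp add: b)
    finally show "(H * H) $$ (i, j) = 1\<^sub>m n $$ (i, j)" .
  qed auto
  have cH: "H \<in> carrier_mat n n" by (simp add: carrier_mat_def)
  have scale: "(c \<cdot>\<^sub>m H) * (c' \<cdot>\<^sub>m H) = 1\<^sub>m n" if "c * c' = 1" for c c'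
  proof -
    have "(c \<cdot>\<^sub>m H) * (c' \<cdot>\<^sub>m H) = c \<cdot>\<^sub>m (c' \<cdot>\<^sub>m (H * H))"
      by (simp only: mult_smult_assoc_mat[OF cH smult_carrier_mat[OF cH]] mult_smult_distrib[OF cH cH])
    also have "\<dots> = 1\<^sub>m n" using that by (auto intro!: eq_matI simp: HH mult.assoc[symmetric])
    finally show ?thesis .
  qed
  have "unitary n (p \<cdot>\<^sub>m H)"
    unfolding unitary_def adj_smult aH using p
    by (auto intro!: smult_carrier_mat cH scale simp: mult.commute)
  moreover have "(p \<cdot>\<^sub>m H) $$ (i, 0) = v $$ (i, 0)" if i: "i < n" for i
  proof -
    have "p * conjugate (w 0) = p * conjugate p * \<alpha> + p * conjugate p"
      by (simp add: w_def a conjugate_dist_add conjugate_dist_mul algebra_simps)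
    then have w0: "p * conjugate (w 0) = 1 + \<alpha>" by (simp add: p)
    have "(p \<cdot>\<^sub>m H) $$ (i, 0) = \<beta> * w i * (p * conjugate (w 0)) - (if i = 0 then p else 0)"
      using i n by (simp add: H_def algebra_simps)
    also have "\<dots> = (1 + \<alpha>) * \<beta> * w i - (if i = 0 then p else 0)" by (simp add: w0 algebra_simps)
    also have "\<dots> = v $$ (i, 0)" by (simp add: b w_def)
    finally show ?thesis .
  qed
  ultimately show ?thesis by (rule that)
qed

section \<open>Deflation at a pair of matching unit vectors\<close>

lemma unitary_first_row_column:
  fixes X :: "'a::{conjugatable_ring,comm_ring_1} mat"
  assumes U: "unitary m U" and V: "unitary n V" and X: "X \<in> carrier_mat m n"
    and u: "u \<in> carrier_mat m 1" "\<And>i. i < m \<Longrightarrow> U $$ (i, 0) = u $$ (i, 0)"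
    and v: "v \<in> carrier_mat n 1" "\<And>i. i < n \<Longrightarrow> V $$ (i, 0) = v $$ (i, 0)"
    and Xv: "X * v = \<mu> \<cdot>\<^sub>m u" and i: "i < m" and n: "n > 0"
  shows "(adj U * X * V) $$ (i, 0) = (if i = 0 then \<mu> else 0)"
proof -
  note [simp] = unitaryD(1,2)[OF U] unitaryD(1,2)[OF V] carrier_matD[OF X] carrier_matD[OF u(1)] carrier_matD[OF v(1)]
  have m: "m > 0" using i by simp
  have "col V 0 = col v 0" "col u 0 = col U 0" using v u n m by (auto intro!: eq_vecI)
  then have 1: "(adj U * X * V) $$ (i, 0) = (adj U * X * v) $$ (i, 0)"
    using i n by simp
  have "adj U * X * v = \<mu> \<cdot>\<^sub>m (adj U * u)"
    by (simp add: mat_assoc Xv) (rule mult_smult_distrib, auto intro!: carrier_matI)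
  then have "(adj U * X * v) $$ (i, 0) = \<mu> * (adj U * u) $$ (i, 0)" using i by simp
  also have "(adj U * u) $$ (i, 0) = (adj U * U) $$ (i, 0)"
    using i \<open>col u 0 = col U 0\<close> m by simp
  also have "\<dots> = (if i = 0 then 1 else 0)" unfolding unitaryD(3)[OF U] using i m by auto
  finally show ?thesis using 1 by simp
qed

text \<open>\<open>Xv\<close> clears the first column and \<open>Xu\<close>, after taking adjoints,
  the first row. With \<open>U = V\<close> and \<open>u = v\<close> this splits off an eigenvector,
  in general a singular pair.\<close>

lemma deflation:
  fixes X :: "'a::{conjugatable_ring,comm_ring_1} mat"
  assumes U: "unitary (Suc m) U" and V: "unitary (Suc n) V" and X: "X \<in> carrier_mat (Suc m) (Suc n)"
    and u: "u \<in> carrier_mat (Suc m) 1" "\<And>i. i < Suc m \<Longrightarrow> U $$ (i, 0) = u $$ (i, 0)"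
    and v: "v \<in> carrier_mat (Suc n) 1" "\<And>i. i < Suc n \<Longrightarrow> V $$ (i, 0) = v $$ (i, 0)"
    and Xv: "X * v = \<mu> \<cdot>\<^sub>m u" and Xu: "adj X * u = \<mu> \<cdot>\<^sub>m v" and \<mu>: "conjugate \<mu> = \<mu>"
  obtains X' where "X' \<in> carrier_mat m n"
    "adj U * X * V = four_block_mat (\<mu> \<cdot>\<^sub>m 1\<^sub>m 1) (0\<^sub>m 1 n) (0\<^sub>m m 1) X'"
proof -
  note [simp] = unitaryD(1,2)[OF U] unitaryD(1,2)[OF V] carrier_matD[OF X]
  define M where "M = adj U * X * V"
  have [simp]: "dim_row M = Suc m" "dim_col M = Suc n" by (simp_all add: M_def)
  have col: "M $$ (i, 0) = (if i = 0 then \<mu> else 0)" if "i < Suc m" for i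
    unfolding M_def by (rule unitary_first_row_column[OF U V X u v Xv that]) simp_all
  have row: "M $$ (0, j) = (if j = 0 then \<mu> else 0)" if j: "j < Suc n" for j
  proof -
    have "adj M = adj V * adj X * U" by (simp add: M_def mat_assoc)
    also have "(adj V * adj X * U) $$ (j, 0) = (if j = 0 then \<mu> else 0)"
      by (rule unitary_first_row_column[OF V U adj_carrier[OF X] v u Xu j]) simp_all
    finally have "conjugate (M $$ (0, j)) = (if j = 0 then \<mu> else 0)" using j by simp
    then have "conjugate (conjugate (M $$ (0, j))) = conjugate (if j = 0 then \<mu> else 0)" by (rule arg_cong)
    then show ?thesis by (simp add: \<mu>)
  qed
  show ?thesis
  proof
    show "adj U * X * V = four_block_mat (\<mu> \<cdot>\<^sub>m 1\<^sub>m 1) (0\<^sub>m 1 n) (0\<^sub>m m 1) (mat m n (\<lambda>(i, j). M $$ (Suc i, Suc j)))"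
      unfolding M_def[symmetric]
      by (rule eq_matI) (auto simp: col row)
  qed simp
qed

section \<open>Hermitian matrices\<close>

lemma complex_unitary_completion:
  fixes v :: "complex mat"
  assumes v: "v \<in> carrier_mat n 1" "adj v * v = 1\<^sub>m 1" and n: "n > 0"
  obtains U where "unitary n U" "\<And>i. i < n \<Longrightarrow> U $$ (i, 0) = v $$ (i, 0)"
proof -
  define a where "a = v $$ (0, 0)"
  \<comment> \<open>Any phase will do for a vanishing entry. The modulus takes the role of \<alpha>,
    so \<open>1 + \<alpha>\<close> is positive.\<close>
  define p where "p = (if a = 0 then 1 else sgn a)"
  have "cmod p = 1" by (simp add: p_def norm_sgn)
  then have p: "p * conjugate p = 1" by (simp flip: complex_norm_square)
  have h: "v $$ (0, 0) = p * of_real (cmod a)"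
    by (simp add: a_def[symmetric] p_def sgn_eq)
  have "1 + cmod a > 0" by (simp add: add_pos_nonneg)
  then have "(1 + cmod a) * inverse (1 + cmod a) = 1" by simp
  then have h': "(1 + of_real (cmod a)) * of_real (inverse (1 + cmod a)) = (1::complex)"
    by (metis of_real_1 of_real_add of_real_mult)
  show thesis
    by (rule unitary_completion[OF v n p h _ h']) (simp, rule that)
qed

text \<open>The work lies in a polar form of the first entry: a dual phase \<open>p\<close> times a
  self-conjugate \<alpha> with \<open>1 + \<alpha>\<close> invertible. An infinitesimal entry is
  treated apart, since its phase has to come from \<open>d\<close>.\<close>

lemma dual_unitary_completion:
  fixes v :: "dual_complex mat"
  assumes v: "v \<in> carrier_mat n 1" "adj v * v = 1\<^sub>m 1" and n: "n > 0"
  obtains U where "unitary n U" "\<And>i. i < n \<Longrightarrow> U $$ (i, 0) = v $$ (i, 0)"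
proof -
  obtain s d where a: "v $$ (0, 0) = DC s d" by (cases "v $$ (0, 0)")
  obtain p \<alpha> where p: "p * conjugate p = 1" and p\<alpha>: "DC s d = p * \<alpha>" and \<alpha>: "conjugate \<alpha> = \<alpha>"
    and pos: "1 + std_part \<alpha> \<noteq> 0"
  proof (cases "s = 0")
    case True
    define q where "q = (if d = 0 then 1 else sgn d)"
    have "cmod q = 1" by (simp add: q_def norm_sgn)
    then have q: "q * cnj q = 1" by (simp flip: complex_norm_square)
    have "d = q * of_real (cmod d)" by (simp add: q_def sgn_eq)
    then show thesis
      using q True by (intro that[of "DC q 0" "DC 0 (of_real (cmod d))"]) (auto intro!: dual_complex_eqI)
  next
    case False
    define r :: complex where "r = of_real (cmod s)"
    \<comment> \<open>The first-order change of the modulus of \<open>s\<close> in direction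
      \<open>d\<close>. The infinitesimal part of the phase is then forced by
      \<open>DC s d = p * \<alpha>\<close>, and fact \<open>2\<close> shows that the phase still has
      modulus one.\<close>
    define e :: complex where "e = of_real (Re (cnj s * d)) / r"
    have "r * e = of_real (Re (cnj s * d))" using False by (simp add: r_def e_def)
    then have "r * e + r * e = cnj s * d + s * cnj d" by (intro complex_eqI) simp_all
    then have r: "r \<noteq> 0" "r * r = s * cnj s" "cnj r = r" "cnj e = e" "r * e + r * e = cnj s * d + s * cnj d"
      using False
      by (simp_all add: r_def e_def complex_norm_square[symmetric] power2_eq_square)
    have 1: "s / r * cnj (s / r) = 1" using r(1) by (simp add: r(3) flip: r(2))
    have "s / r * cnj ((d - s / r * e) / r) + (d - s / r * e) / r * cnj (s / r) =
      (s * cnj d + cnj s * d - (s * cnj s / (r * r)) * (r * e + r * e)) / (r * r)"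
      using r(1) by (simp add: r(3,4) field_simps)
    also have "\<dots> = 0" using r by simp
    finally have 2: "s / r * cnj ((d - s / r * e) / r) + (d - s / r * e) / r * cnj (s / r) = 0" .
    have "Re (1 + r) > 0" by (simp add: r_def add_pos_nonneg)
    then have 3: "1 + r \<noteq> 0" by (metis less_irrefl zero_complex.sel(1))
    show thesis
    proof (rule that[of "DC (s / r) ((d - s / r * e) / r)" "DC r e"])
      show "DC (s / r) ((d - s / r * e) / r) * conjugate (DC (s / r) ((d - s / r * e) / r)) = 1"
        by (rule dual_complex_eqI) (simp_all only: dual_complex_simps dual_complex.sel 1 2)
      show "DC s d = DC (s / r) ((d - s / r * e) / r) * DC r e"
        using r(1) by (intro dual_complex_eqI) simp_all
      show "conjugate (DC r e) = DC r e"
        using r(3,4) by (intro dual_complex_eqI) simp_all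
      show "1 + std_part (DC r e) \<noteq> 0" using 3 by simp
    qed
  qed
  \<comment> \<open>The reciprocal of \<open>1 + \<alpha>\<close>, expanded to first order in
    \<epsilon>.\<close>
  define \<beta> where "\<beta> = DC (1 / (1 + std_part \<alpha>)) (- inf_part \<alpha> / (1 + std_part \<alpha>) ^ 2)"
  have h: "(1 + \<alpha>) * \<beta> = 1"
    using pos by (auto intro!: dual_complex_eqI simp: \<beta>_def power2_eq_square)
  show thesis
    by (rule unitary_completion[OF v n p a[unfolded p\<alpha>] \<alpha> h]) (rule that)
qed

lemma normalize_complex:
  fixes w :: "complex mat"
  assumes w: "w \<in> carrier_mat n 1" and i: "i < n" "w $$ (i, 0) \<noteq> 0"
  obtains c where "adj (c \<cdot>\<^sub>m w) * (c \<cdot>\<^sub>m w) = 1\<^sub>m 1"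
proof -
  define s where "s = (\<Sum>k<n. (cmod (w $$ (k, 0)))\<^sup>2)"
  have "s > 0" unfolding s_def using i by (intro sum_pos2[of _ i]) auto
  define c where "c = complex_of_real (1 / sqrt s)"
  have "adj (c \<cdot>\<^sub>m w) * (c \<cdot>\<^sub>m w) = 1\<^sub>m 1"
  proof (rule eq_matI)
    fix j k assume "j < dim_row (1\<^sub>m 1 :: complex mat)" "k < dim_col (1\<^sub>m 1 :: complex mat)"
    then have [simp]: "j = 0" "k = 0" by auto
    have "(adj (c \<cdot>\<^sub>m w) * (c \<cdot>\<^sub>m w)) $$ (j, k) = (\<Sum>k<n. (c * cnj c) * (w $$ (k, 0) * cnj (w $$ (k, 0))))"
      using w by (simp add: scalar_prod_def atLeast0LessThan carrier_matD mult_ac)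
    also have "\<dots> = (c * cnj c) * of_real s"
      unfolding sum_distrib_left[symmetric] s_def of_real_sum complex_norm_square ..
    also have "\<dots> = of_real (1 / sqrt s * (1 / sqrt s) * s)"
      by (simp only: c_def complex_cnj_complex_of_real of_real_mult)
    also have "1 / sqrt s * (1 / sqrt s) * s = 1" using \<open>s > 0\<close> by (simp add: field_simps)
    finally show "(adj (c \<cdot>\<^sub>m w) * (c \<cdot>\<^sub>m w)) $$ (j, k) = 1\<^sub>m 1 $$ (j, k)" by simp
  qed (use w in auto)
  then show thesis by (rule that)
qed

lemma hermitian_eigenvalue_real:
  fixes A :: "complex mat"
  assumes A: "A \<in> carrier_mat n n" "adj A = A" and v: "v \<in> carrier_mat n 1" "adj v * v = 1\<^sub>m 1"
    and e: "A * v = \<nu> \<cdot>\<^sub>m v"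
  shows "cnj \<nu> = \<nu>"
proof -
  note [simp] = carrier_matD[OF A(1)] carrier_matD[OF v(1)]
  have "adj v * A * v = \<nu> \<cdot>\<^sub>m (adj v * v)"
    by (simp add: mat_assoc e) (rule mult_smult_distrib[OF adj_carrier[OF v(1)] v(1)])
  then have 1: "adj v * A * v = \<nu> \<cdot>\<^sub>m 1\<^sub>m 1" by (simp only: v)
  have "adj (adj v * A * v) = adj v * A * v" by (simp add: A(2) mat_assoc)
  then have "conjugate \<nu> \<cdot>\<^sub>m 1\<^sub>m 1 = \<nu> \<cdot>\<^sub>m 1\<^sub>m 1" unfolding 1 by simp
  then have "(conjugate \<nu> \<cdot>\<^sub>m 1\<^sub>m 1) $$ (0, 0) = (\<nu> \<cdot>\<^sub>m 1\<^sub>m 1) $$ (0, 0)" by (rule arg_cong)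
  then show ?thesis by simp
qed

lemma hermitian_eigenpair:
  fixes A :: "complex mat"
  assumes A: "A \<in> carrier_mat n n" "adj A = A" and n: "n > 0"
  obtains v \<nu> where "v \<in> carrier_mat n 1" "adj v * v = 1\<^sub>m 1" "A * v = \<nu> \<cdot>\<^sub>m v" "cnj \<nu> = \<nu>"
proof -
  obtain \<nu> x where "eigenvector A x \<nu>"
    using spectrum_non_empty[OF A(1)] n by (auto simp: spectrum_def eigenvalue_def)
  then have x: "x \<in> carrier_vec n" "x \<noteq> 0\<^sub>v n" "A *\<^sub>v x = \<nu> \<cdot>\<^sub>v x"
    using A by (auto simp: eigenvector_def carrier_matD)
  then obtain i where i: "i < n" "x $ i \<noteq> 0" by (auto simp: vec_eq_iff)
  define w where "w = mat n 1 (\<lambda>(i, _). x $ i)"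
  have w: "w \<in> carrier_mat n 1" by (simp add: w_def)
  have cw: "col w 0 = x" using x by (auto simp: w_def)
  have Aw: "A * w = \<nu> \<cdot>\<^sub>m w"
  proof (rule eq_matI)
    fix i j assume "i < dim_row (\<nu> \<cdot>\<^sub>m w)" "j < dim_col (\<nu> \<cdot>\<^sub>m w)"
    then have ij: "i < n" "j = 0" by (auto simp: w_def)
    then have "(A * w) $$ (i, j) = (A *\<^sub>v x) $ i" using A w by (simp add: cw carrier_matD)
    then show "(A * w) $$ (i, j) = (\<nu> \<cdot>\<^sub>m w) $$ (i, j)" using x ij by (simp add: w_def)
  qed (use A in \<open>auto simp: w_def carrier_matD\<close>)
  obtain c where c: "adj (c \<cdot>\<^sub>m w) * (c \<cdot>\<^sub>m w) = 1\<^sub>m 1"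
    using normalize_complex[OF w i(1)] i by (auto simp: w_def)
  have "A * (c \<cdot>\<^sub>m w) = c \<cdot>\<^sub>m (\<nu> \<cdot>\<^sub>m w)" unfolding mult_smult_distrib[OF A(1) w] Aw ..
  also have "\<dots> = \<nu> \<cdot>\<^sub>m (c \<cdot>\<^sub>m w)" by (auto intro!: eq_matI)
  finally have e: "A * (c \<cdot>\<^sub>m w) = \<nu> \<cdot>\<^sub>m (c \<cdot>\<^sub>m w)" .
  show thesis
    by (rule that[OF _ c e hermitian_eigenvalue_real[OF A _ c e]]) (use w in auto)
qed

text \<open>In such a basis the eigenspaces of a standard part become sets of indices, which is the
  setting of \<open>first_order_eigenvector\<close>.\<close>

lemma hermitian_diagonalization:
  fixes A :: "complex mat"
  assumes "A \<in> carrier_mat n n" "adj A = A"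
  shows "\<exists>U. unitary n U \<and> diagonal_mat (adj U * A * U)"
  using assms
proof (induction n arbitrary: A)
  case 0
  then show ?case by (intro exI[of _ "1\<^sub>m 0"]) (auto simp: diagonal_mat_def)
next
  case (Suc n)
  obtain v \<nu> where v: "v \<in> carrier_mat (Suc n) 1" "adj v * v = 1\<^sub>m 1" and e: "A * v = \<nu> \<cdot>\<^sub>m v" "cnj \<nu> = \<nu>"
    using hermitian_eigenpair[OF Suc.prems] by blast
  obtain U where U: "unitary (Suc n) U" and Uv: "\<And>i. i < Suc n \<Longrightarrow> U $$ (i, 0) = v $$ (i, 0)"
    using complex_unitary_completion[OF v] by blast
  obtain A' where A': "A' \<in> carrier_mat n n"
    and fb: "adj U * A * U = four_block_mat (\<nu> \<cdot>\<^sub>m 1\<^sub>m 1) (0\<^sub>m 1 n) (0\<^sub>m n 1) A'"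
    using deflation[OF U U Suc.prems(1) v(1) Uv v(1) Uv e(1)] e Suc.prems(2) by auto
  note [simp] = unitaryD(1,2)[OF U] carrier_matD[OF Suc.prems(1)] carrier_matD[OF A']
  have "adj (adj U * A * U) = adj U * A * U" by (simp add: mat_assoc Suc.prems)
  then have fbh: "four_block_mat (\<nu> \<cdot>\<^sub>m 1\<^sub>m 1) (0\<^sub>m 1 n) (0\<^sub>m n 1) (adj A') = four_block_mat (\<nu> \<cdot>\<^sub>m 1\<^sub>m 1) (0\<^sub>m 1 n) (0\<^sub>m n 1) A'"
    unfolding fb by (subst (asm) adj_four_block[of _ 1 1 _ n _ n]) (auto simp: A' e)
  have "adj A' = A'"
  proof (rule eq_matI)
    fix i j assume "i < dim_row A'" "j < dim_col A'"
    then show "adj A' $$ (i, j) = A' $$ (i, j)"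
      using arg_cong[OF fbh, of "\<lambda>M. M $$ (Suc i, Suc j)"] by simp
  qed auto
  then obtain U' where U': "unitary n U'" "diagonal_mat (adj U' * A' * U')"
    using Suc.IH[OF A'] by blast
  note [simp] = unitaryD(1,2)[OF U'(1)]
  let ?W = "block_ext 1 U'"
  have "adj (U * ?W) * A * (U * ?W) = adj ?W * (adj U * A * U) * ?W" by (simp add: mat_assoc)
  also have "\<dots> = four_block_mat (\<nu> \<cdot>\<^sub>m 1\<^sub>m 1) (0\<^sub>m 1 n) (0\<^sub>m n 1) (adj U' * A' * U')"
    unfolding fb by (rule block_ext_conj) (auto simp: A' U')
  finally have "diagonal_mat (adj (U * ?W) * A * (U * ?W))"
    using U'(2) by (auto simp: diagonal_mat_def)
  moreover have "unitary (Suc n) (U * ?W)"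
    using unitary_mult[OF U] unitary_block_ext[OF U'(1), of 1] by simp
  ultimately show ?case by blast
qed

lemma unitary_conj_cancel:
  fixes A :: "'a::{conjugatable_ring,comm_ring_1} mat"
  assumes U: "unitary m U" and V: "unitary n V" and A: "A \<in> carrier_mat m n"
  shows "U * (adj U * A * V) * adj V = A"
proof -
  note [simp] = unitaryD(1,2)[OF U] unitaryD(1,2)[OF V] carrier_matD[OF A]
  have "U * (adj U * A * V) * adj V = (U * adj U) * A * (V * adj V)" by (simp add: mat_assoc)
  then show ?thesis unfolding unitaryD(4)[OF U] unitaryD(4)[OF V] using A by simp
qed

section \<open>Eigenvectors of dual Hermitian matrices\<close>

lemma diagonal_mult_index:
  fixes D v :: "'a::comm_semiring_0 mat"
  assumes D: "D \<in> carrier_mat n n" "diagonal_mat D" and v: "v \<in> carrier_mat n k" and ij: "i < n" "j < k"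
  shows "(D * v) $$ (i, j) = D $$ (i, i) * v $$ (i, j)"
proof -
  have "(D * v) $$ (i, j) = (\<Sum>l<n. D $$ (i, l) * v $$ (l, j))"
    using D(1) v ij by (simp add: scalar_prod_def atLeast0LessThan carrier_matD)
  also have "\<dots> = (\<Sum>l\<in>{i}. D $$ (i, l) * v $$ (l, j))"
    using D ij by (intro sum.mono_neutral_right) (auto simp: diagonal_mat_def carrier_matD)
  finally show ?thesis by simp
qed

text \<open>An arbitrary eigenvalue might be 0. After diagonalisation, some diagonal entry is
  nonzero, since otherwise \<open>A\<close> itself would vanish.\<close>

lemma hermitian_nonzero_eigenpair:
  fixes A :: "complex mat"
  assumes A: "A \<in> carrier_mat n n" "adj A = A" and A0: "A \<noteq> 0\<^sub>m n n"
  obtains v \<nu> where "v \<in> carrier_mat n 1" "adj v * v = 1\<^sub>m 1" "A * v = \<nu> \<cdot>\<^sub>m v" "\<nu> \<noteq> 0" "cnj \<nu> = \<nu>"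
proof -
  obtain U where U: "unitary n U" and dg: "diagonal_mat (adj U * A * U)"
    using hermitian_diagonalization[OF A] by blast
  note [simp] = unitaryD(1,2)[OF U] carrier_matD[OF A(1)]
  define D where "D = adj U * A * U"
  have D: "D \<in> carrier_mat n n" by (rule carrier_matI) (simp_all add: D_def)
  have dD: "diagonal_mat D" using dg by (simp only: D_def)
  note [simp] = carrier_matD[OF D]
  have "\<exists>k<n. D $$ (k, k) \<noteq> 0"
  proof (rule ccontr)
    assume "\<not> ?thesis"
    then have "D $$ (i, j) = 0" if "i < n" "j < n" for i j
      using dD that by (cases "i = j") (auto simp: diagonal_mat_def)
    then have "D = 0\<^sub>m n n" by (rule_tac eq_matI) simp_all
    then have "U * D * adj U = 0\<^sub>m n n" by simp
    then show False using unitary_conj_cancel[OF U U A(1)] A0 by (simp add: D_def)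
  qed
  then obtain k where k: "k < n" "D $$ (k, k) \<noteq> 0" by blast
  define e where "e = mat n 1 (\<lambda>(i, _). if i = k then 1 else 0 :: complex)"
  have e: "e \<in> carrier_mat n 1" by (simp add: e_def)
  note [simp] = carrier_matD[OF e]
  have De: "D * e = D $$ (k, k) \<cdot>\<^sub>m e"
  proof (rule eq_matI)
    fix i j assume "i < dim_row (D $$ (k, k) \<cdot>\<^sub>m e)" "j < dim_col (D $$ (k, k) \<cdot>\<^sub>m e)"
    then show "(D * e) $$ (i, j) = (D $$ (k, k) \<cdot>\<^sub>m e) $$ (i, j)"
      by (subst diagonal_mult_index[OF D dD e]) (auto simp: e_def)
  qed simp_all
  have ee: "adj e * e = 1\<^sub>m 1"
    by (rule eq_matI) (use k in \<open>auto simp: scalar_prod_def e_def if_distrib cong: if_cong\<close>)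
  have Ue: "U * e \<in> carrier_mat n 1" by (rule carrier_matI) simp_all
  have "adj (U * e) * (U * e) = adj e * (adj U * U) * e" by (simp add: mat_assoc)
  also have "\<dots> = 1\<^sub>m 1" unfolding unitaryD(3)[OF U] using ee e by simp
  finally have 1: "adj (U * e) * (U * e) = 1\<^sub>m 1" .
  have "A * (U * e) = (U * adj U) * A * (U * e)" unfolding unitaryD(4)[OF U] using A by simp
  also have "\<dots> = U * (D * e)" by (simp add: D_def mat_assoc)
  also have "\<dots> = D $$ (k, k) \<cdot>\<^sub>m (U * e)"
    unfolding De by (rule mult_smult_distrib[OF _ e]) (rule carrier_matI, simp_all)
  finally have 2: "A * (U * e) = D $$ (k, k) \<cdot>\<^sub>m (U * e)" .
  show thesis by (rule that[OF Ue 1 2 k(2) hermitian_eigenvalue_real[OF A Ue 1 2]])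
qed

text \<open>Eigenvector of the dual matrix \<open>D + M\<epsilon>\<close> whose standard part \<open>D\<close> is diagonal: inside the
  eigenspace \<open>S\<close> of a nonzero eigenvalue of \<open>D\<close>, take an eigenvector of the compression of \<open>M\<close>,
  and correct it outside of \<open>S\<close> to first order. Adding \<open>c\<close> times the projector onto \<open>S\<close>
  keeps the compression nonzero, so that some eigenvector lies in the span of \<open>S\<close>.\<close>

lemma first_order_eigenvector:
  fixes D M :: "complex mat"
  assumes D: "D \<in> carrier_mat n n" "diagonal_mat D" and M: "M \<in> carrier_mat n n" "adj M = M"
    and k: "k < n"
  obtains x y \<nu> where "x \<in> carrier_mat n 1" "y \<in> carrier_mat n 1" "adj x * x = 1\<^sub>m 1" "adj x * y = 0\<^sub>m 1 1"
    "D * x = D $$ (k, k) \<cdot>\<^sub>m x" "D * y + M * x = D $$ (k, k) \<cdot>\<^sub>m y + \<nu> \<cdot>\<^sub>m x" "cnj \<nu> = \<nu>"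
proof -
  note dims [simp] = carrier_matD[OF D(1)] carrier_matD[OF M(1)]
  define S where "S = {i. D $$ (i, i) = D $$ (k, k)}"
  define T where "T c = mat n n (\<lambda>(i, j). if i \<in> S \<and> j \<in> S then M $$ (i, j) + (if i = j then c else 0) else 0)" for c
  have Mc: "cnj (M $$ (j, i)) = M $$ (i, j)" if "i < n" "j < n" for i j
    using arg_cong[OF M(2), of "\<lambda>M. M $$ (i, j)"] that by simp
  have T: "T c \<in> carrier_mat n n" for c by (simp add: T_def)
  have aT: "adj (T c) = T c" if "cnj c = c" for c
    by (rule eq_matI) (use that in \<open>auto simp: T_def Mc\<close>)
  \<comment> \<open>The two matrices differ at \<open>k\<close>, so one of the shifts 0 and 1 is
    suitable; both are real and keep \<open>T c\<close> Hermitian.\<close>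
  have "T 0 $$ (k, k) \<noteq> T 1 $$ (k, k)" using k by (simp add: T_def S_def)
  then have "T 0 $$ (k, k) \<noteq> 0 \<or> T 1 $$ (k, k) \<noteq> 0" by auto
  then have "T 0 \<noteq> 0\<^sub>m n n \<or> T 1 \<noteq> 0\<^sub>m n n" using k by auto
  then obtain c where c: "T c \<noteq> 0\<^sub>m n n" "cnj c = c" by auto
  obtain x \<nu> where x: "x \<in> carrier_mat n 1" "adj x * x = 1\<^sub>m 1" and e: "T c * x = \<nu> \<cdot>\<^sub>m x" and \<nu>: "\<nu> \<noteq> 0" "cnj \<nu> = \<nu>"
    using hermitian_nonzero_eigenpair[OF T aT[OF c(2)] c(1)] by blast
  note [simp] = carrier_matD[OF x(1)]
  have e': "(\<Sum>j<n. T c $$ (i, j) * x $$ (j, 0)) = \<nu> * x $$ (i, 0)" if "i < n" for i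
    using arg_cong[OF e, of "\<lambda>M. M $$ (i, 0)"] that T[of c]
    by (simp add: scalar_prod_def atLeast0LessThan carrier_matD)
  \<comment> \<open>Outside \<open>S\<close> the rows of \<open>T c\<close> vanish, and the
    eigenvalue is nonzero.\<close>
  have x0: "x $$ (i, 0) = 0" if i: "i < n" "i \<notin> S" for i
  proof -
    have "(\<Sum>j<n. T c $$ (i, j) * x $$ (j, 0)) = 0" using i by (intro sum.neutral) (auto simp: T_def)
    then show ?thesis using e'[OF i(1)] \<nu> by simp
  qed
  have Mx: "(M * x) $$ (i, 0) = (\<nu> - c) * x $$ (i, 0)" if i: "i < n" "i \<in> S" for i
  proof -
    have "(M * x) $$ (i, 0) = (\<Sum>j<n. M $$ (i, j) * x $$ (j, 0))"
      using i by (simp add: scalar_prod_def atLeast0LessThan)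
    also have "\<dots> = (\<Sum>j<n. T c $$ (i, j) * x $$ (j, 0) - (if j = i then c * x $$ (i, 0) else 0))"
      using i by (intro sum.cong) (auto simp: T_def x0 algebra_simps)
    also have "\<dots> = (\<nu> - c) * x $$ (i, 0)"
      using i by (simp only: sum_subtractf e'[OF i(1)]) (simp add: algebra_simps)
    finally show ?thesis .
  qed
  \<comment> \<open>Outside \<open>S\<close> this solves the first-order equation, whose divisor is
    nonzero there. The components on \<open>S\<close> are free; setting them to 0 gives
    \<open>x\<close> and \<open>y\<close> disjoint supports, hence \<open>adj x * y\<close>
    vanishes.\<close>
  define y where "y = mat n 1 (\<lambda>(i, _). if i \<in> S then 0 else (M * x) $$ (i, 0) / (D $$ (k, k) - D $$ (i, i)))"
  have y: "y \<in> carrier_mat n 1" by (simp add: y_def)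
  note [simp] = carrier_matD[OF y]
  have "adj x * y = 0\<^sub>m 1 1"
  proof (rule eq_matI)
    fix i j assume "i < dim_row (0\<^sub>m 1 1 :: complex mat)" "j < dim_col (0\<^sub>m 1 1 :: complex mat)"
    then have [simp]: "i = 0" "j = 0" by auto
    have "(adj x * y) $$ (i, j) = (\<Sum>l<n. cnj (x $$ (l, 0)) * y $$ (l, 0))"
      by (simp add: scalar_prod_def atLeast0LessThan)
    also have "\<dots> = 0" by (intro sum.neutral) (auto simp: y_def x0)
    finally show "(adj x * y) $$ (i, j) = 0\<^sub>m 1 1 $$ (i, j)" by simp
  qed simp_all
  moreover have "D * x = D $$ (k, k) \<cdot>\<^sub>m x"
  proof (rule eq_matI)
    fix i j assume "i < dim_row (D $$ (k, k) \<cdot>\<^sub>m x)" "j < dim_col (D $$ (k, k) \<cdot>\<^sub>m x)"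
    then have i: "i < n" and [simp]: "j = 0" by auto
    show "(D * x) $$ (i, j) = (D $$ (k, k) \<cdot>\<^sub>m x) $$ (i, j)"
      using i by (cases "i \<in> S") (auto simp: diagonal_mult_index[OF D x(1)] x0 S_def simp del: index_mult_mat(1))
  qed simp_all
  moreover have "D * y + M * x = D $$ (k, k) \<cdot>\<^sub>m y + (\<nu> - c) \<cdot>\<^sub>m x"
  proof (rule eq_matI)
    fix i j assume "i < dim_row (D $$ (k, k) \<cdot>\<^sub>m y + (\<nu> - c) \<cdot>\<^sub>m x)" "j < dim_col (D $$ (k, k) \<cdot>\<^sub>m y + (\<nu> - c) \<cdot>\<^sub>m x)"
    then have i: "i < n" and [simp]: "j = 0" by auto
    have 1: "(D * y + M * x) $$ (i, j) = D $$ (i, i) * y $$ (i, 0) + (M * x) $$ (i, 0)"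
      using i diagonal_mult_index[OF D y i, of 0] by (simp del: index_mult_mat(1))
    show "(D * y + M * x) $$ (i, j) = (D $$ (k, k) \<cdot>\<^sub>m y + (\<nu> - c) \<cdot>\<^sub>m x) $$ (i, j)"
    proof (cases "i \<in> S")
      case True
      then show ?thesis unfolding 1 Mx[OF i True] using i by (simp add: y_def)
    next
      case False
      then have "D $$ (k, k) - D $$ (i, i) \<noteq> 0" by (simp add: S_def)
      moreover have "y $$ (i, 0) = (M * x) $$ (i, 0) / (D $$ (k, k) - D $$ (i, i))"
        using False i by (simp add: y_def del: index_mult_mat(1))
      ultimately have "(D $$ (k, k) - D $$ (i, i)) * y $$ (i, 0) = (M * x) $$ (i, 0)" by (simp del: index_mult_mat(1))
      then show ?thesis unfolding 1 using i False by (simp add: x0 algebra_simps del: index_mult_mat(1))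
    qed
  qed simp_all
  ultimately show thesis using x y c \<nu> by (intro that[of x y "\<nu> - c"]) auto
qed

text \<open>In the basis \<open>U\<close>, the standard and infinitesimal parts of the eigenvalue
  equation are the two equations of \<open>first_order_eigenvector\<close>. The standard part of
  \<nu> must be nonzero because the singular value built from it has to be invertible.\<close>

lemma dual_hermitian_eigenpair:
  assumes H: "H \<in> carrier_mat n n" "adj H = H" and H0: "std_mat H \<noteq> 0\<^sub>m n n"
  obtains v \<nu> where "v \<in> carrier_mat n 1" "adj v * v = 1\<^sub>m 1" "H * v = \<nu> \<cdot>\<^sub>m v" "conjugate \<nu> = \<nu>" "std_part \<nu> \<noteq> 0"
proof -
  note [simp] = carrier_matD[OF H(1)]
  have Hs: "std_mat H \<in> carrier_mat n n" "adj (std_mat H) = std_mat H"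
    and Hd: "inf_mat H \<in> carrier_mat n n" "adj (inf_mat H) = inf_mat H"
    using H by (simp_all flip: std_mat_adj inf_mat_adj)
  obtain U where U: "unitary n U" and dg: "diagonal_mat (adj U * std_mat H * U)"
    using hermitian_diagonalization[OF Hs] by blast
  note [simp] = unitaryD(1,2)[OF U]
  define D where "D = adj U * std_mat H * U"
  define M where "M = adj U * inf_mat H * U"
  have D: "D \<in> carrier_mat n n" "adj D = D" and M: "M \<in> carrier_mat n n" "adj M = M"
    by (rule carrier_matI, simp_all add: D_def M_def mat_assoc Hs(2) Hd(2))+
  have dD: "diagonal_mat D" using dg by (simp only: D_def)
  note [simp] = carrier_matD[OF D(1)] carrier_matD[OF M(1)]
  have "\<exists>k<n. D $$ (k, k) \<noteq> 0"
  proof (rule ccontr)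
    assume "\<not> ?thesis"
    then have "D $$ (i, j) = 0" if "i < n" "j < n" for i j
      using dD that by (cases "i = j") (auto simp: diagonal_mat_def)
    then have "D = 0\<^sub>m n n" by (rule_tac eq_matI) simp_all
    then have "U * D * adj U = 0\<^sub>m n n" by simp
    then show False using unitary_conj_cancel[OF U U Hs(1)] H0 by (simp add: D_def)
  qed
  then obtain k where k: "k < n" "D $$ (k, k) \<noteq> 0" by blast
  have ck: "cnj (D $$ (k, k)) = D $$ (k, k)"
    using arg_cong[OF D(2), of "\<lambda>M. M $$ (k, k)"] k by simp
  obtain x y \<mu> where x: "x \<in> carrier_mat n 1" and y: "y \<in> carrier_mat n 1"
    and xx: "adj x * x = 1\<^sub>m 1" and xy: "adj x * y = 0\<^sub>m 1 1" and Dx: "D * x = D $$ (k, k) \<cdot>\<^sub>m x"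
    and Dy: "D * y + M * x = D $$ (k, k) \<cdot>\<^sub>m y + \<mu> \<cdot>\<^sub>m x" and \<mu>: "cnj \<mu> = \<mu>"
    using first_order_eigenvector[OF D(1) dD M k(1)] by blast
  note [simp] = carrier_matD[OF x] carrier_matD[OF y]
  have yx: "adj y * x = 0\<^sub>m 1 1" using arg_cong[OF xy, of adj] by simp
  have iso: "adj (U * a) * (U * b) = adj a * b" if "dim_row a = n" "dim_row b = n" for a b
  proof -
    have "adj (U * a) * (U * b) = adj a * ((adj U * U) * b)" using that by (simp add: mat_assoc)
    then show ?thesis unfolding unitaryD(3)[OF U] using that by simp
  qed
  have UD: "std_mat H * (U * a) = U * (D * a)" "inf_mat H * (U * a) = U * (M * a)" if "dim_row a = n" for a
  proof -
    have "(U * adj U) * (X * (U * a)) = U * ((adj U * X * U) * a)" if "X \<in> carrier_mat n n" for X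
      using \<open>dim_row a = n\<close> carrier_matD[OF that] by (simp add: mat_assoc)
    from this[OF Hs(1)] this[OF Hd(1)] show "std_mat H * (U * a) = U * (D * a)" "inf_mat H * (U * a) = U * (M * a)"
      unfolding unitaryD(4)[OF U] by (simp_all add: D_def M_def)
  qed
  have cU: "U \<in> carrier_mat n n" by (rule carrier_matI) simp_all
  define v where "v = mat n 1 (\<lambda>ij. DC ((U * x) $$ ij) ((U * y) $$ ij))"
  have v: "v \<in> carrier_mat n 1" by (simp add: v_def)
  have sv: "std_mat v = U * x" and iv: "inf_mat v = U * y" unfolding v_def by (rule eq_matI; simp)+
  note [simp] = carrier_matD[OF v]
  have n: "adj v * v = 1\<^sub>m 1"
  proof (rule dual_mat_eqI)
    show "std_mat (adj v * v) = std_mat (1\<^sub>m 1)"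
      by (simp add: sv iso xx del: adj_mult) (auto intro!: eq_matI)
    show "inf_mat (adj v * v) = inf_mat (1\<^sub>m 1)"
      by (simp add: sv iv iso xy yx del: adj_mult) (auto intro!: eq_matI)
  qed
  have e: "H * v = DC (D $$ (k, k)) \<mu> \<cdot>\<^sub>m v"
  proof (rule dual_mat_eqI)
    have "std_mat (H * v) = D $$ (k, k) \<cdot>\<^sub>m (U * x)"
      by (simp add: sv UD Dx mult_smult_distrib[OF cU x])
    also have "\<dots> = std_mat (DC (D $$ (k, k)) \<mu> \<cdot>\<^sub>m v)" by (rule eq_matI) (auto simp: sv[symmetric])
    finally show "std_mat (H * v) = std_mat (DC (D $$ (k, k)) \<mu> \<cdot>\<^sub>m v)" .
    have "inf_mat (H * v) = U * (D * y) + U * (M * x)" by (simp add: sv iv UD)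
    also have "\<dots> = U * (D * y + M * x)"
      by (rule mult_add_distrib_mat[OF cU, symmetric]) (auto intro!: carrier_matI)
    also have "\<dots> = D $$ (k, k) \<cdot>\<^sub>m (U * y) + \<mu> \<cdot>\<^sub>m (U * x)"
      unfolding Dy by (simp add: mult_add_distrib_mat[OF cU smult_carrier_mat[OF y] smult_carrier_mat[OF x]]
        mult_smult_distrib[OF cU x] mult_smult_distrib[OF cU y])
    also have "\<dots> = inf_mat (DC (D $$ (k, k)) \<mu> \<cdot>\<^sub>m v)" by (rule eq_matI) (auto simp: sv[symmetric] iv[symmetric])
    finally show "inf_mat (H * v) = inf_mat (DC (D $$ (k, k)) \<mu> \<cdot>\<^sub>m v)" .
  qed
  show thesis
    by (rule that[OF v n e]) (use k ck \<mu> in \<open>auto intro: dual_complex_eqI\<close>)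
qed

section \<open>Singular value decomposition\<close>

lemma gram_index:
  fixes w :: "complex mat"
  assumes "j < dim_col w"
  shows "(adj w * w) $$ (j, j) = of_real (\<Sum>i<dim_row w. (cmod (w $$ (i, j)))\<^sup>2)"
proof -
  have "(adj w * w) $$ (j, j) = (\<Sum>i<dim_row w. w $$ (i, j) * cnj (w $$ (i, j)))"
    using assms by (simp add: scalar_prod_def atLeast0LessThan mult.commute)
  then show ?thesis unfolding of_real_sum complex_norm_square .
qed

text \<open>A diagonal entry of the Gram matrix is a sum of squared moduli. This is special to
  complex matrices: an infinitesimal dual matrix has Gram matrix 0, so deflation has to stop
  there.\<close>

lemma gram_eq_zero:
  fixes w :: "complex mat"
  assumes "adj w * w = 0\<^sub>m (dim_col w) (dim_col w)"
  shows "w = 0\<^sub>m (dim_row w) (dim_col w)"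
proof (rule eq_matI)
  fix i j assume "i < dim_row (0\<^sub>m (dim_row w) (dim_col w) :: complex mat)"
    "j < dim_col (0\<^sub>m (dim_row w) (dim_col w) :: complex mat)"
  then have ij: "i < dim_row w" "j < dim_col w" by auto
  have "complex_of_real (\<Sum>i<dim_row w. (cmod (w $$ (i, j)))\<^sup>2) = 0"
    unfolding gram_index[OF ij(2), symmetric] assms using ij by simp
  then have "(\<Sum>i<dim_row w. (cmod (w $$ (i, j)))\<^sup>2) = 0" by (simp only: of_real_eq_0_iff)
  then have "(cmod (w $$ (i, j)))\<^sup>2 = 0" using ij by (subst (asm) sum_nonneg_eq_0_iff) auto
  then show "w $$ (i, j) = 0\<^sub>m (dim_row w) (dim_col w) $$ (i, j)" using ij by simp
qed simp_all

lemma positive_appreciable_sqrt: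
  assumes "positive_appreciable l"
  obtains \<mu> \<kappa> where "positive_appreciable \<mu>" "\<mu> * \<mu> = l" "\<kappa> * \<mu> = 1" "conjugate \<mu> = \<mu>" "conjugate \<kappa> = \<kappa>"
proof -
  obtain a b where l: "l = DC (of_real a) (of_real b)" "a > 0"
    using assms by (cases l) (auto simp: positive_appreciable_def is_dual_number_def elim!: Reals_cases)
  define s where "s = sqrt a"
  have s: "s > 0" "s * s = a" using l by (simp_all add: s_def)
  \<comment> \<open>The term \<open>b / (2 * s)\<close> is \<open>b\<close> times the derivative of
    the square root at \<open>a\<close>; \<kappa> is the reciprocal of \<mu> to first order.\<close>
  define \<mu> where "\<mu> = DC (of_real s) (of_real (b / (2 * s)))"
  define \<kappa> where "\<kappa> = DC (of_real (1 / s)) (of_real (- b / (2 * s) / (s * s)))"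
  have "s * (b / (2 * s)) + b / (2 * s) * s = b" "1 / s * s = 1"
    "1 / s * (b / (2 * s)) + - b / (2 * s) / (s * s) * s = 0"
    using s(1) by (simp_all add: field_simps)
  note h = s(2) this
  have "std_part (\<mu> * \<mu>) = of_real (s * s)" "inf_part (\<mu> * \<mu>) = of_real (s * (b / (2 * s)) + b / (2 * s) * s)"
    "std_part (\<kappa> * \<mu>) = of_real (1 / s * s)"
    "inf_part (\<kappa> * \<mu>) = of_real (1 / s * (b / (2 * s)) + - b / (2 * s) / (s * s) * s)"
    unfolding \<mu>_def \<kappa>_def dual_complex_simps dual_complex.sel by (simp_all only: of_real_mult of_real_add)
  then show thesis unfolding h
    by (intro that[of \<mu> \<kappa>])
       (auto simp: l \<mu>_def \<kappa>_def positive_appreciable_def is_dual_number_def s intro!: dual_complex_eqI)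
qed

lemma dual_singular_triple:
  assumes A: "A \<in> carrier_mat m n" and A0: "std_mat A \<noteq> 0\<^sub>m m n"
  obtains u v \<mu> where "u \<in> carrier_mat m 1" "v \<in> carrier_mat n 1" "adj u * u = 1\<^sub>m 1" "adj v * v = 1\<^sub>m 1"
    "A * v = \<mu> \<cdot>\<^sub>m u" "adj A * u = \<mu> \<cdot>\<^sub>m v" "positive_appreciable \<mu>" "conjugate \<mu> = \<mu>"
proof -
  note [simp] = carrier_matD[OF A]
  have H: "adj A * A \<in> carrier_mat n n" "adj (adj A * A) = adj A * A" by (rule carrier_matI) simp_all
  have "std_mat (adj A * A) \<noteq> 0\<^sub>m n n"
    using A0 gram_eq_zero[of "std_mat A"] by auto
  then obtain v l where v: "v \<in> carrier_mat n 1" "adj v * v = 1\<^sub>m 1" and e: "adj A * A * v = l \<cdot>\<^sub>m v"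
    and cl: "conjugate l = l" and l0: "std_part l \<noteq> 0"
    using dual_hermitian_eigenpair[OF H] by blast
  note [simp] = carrier_matD[OF v(1)]
  have Av: "A * v \<in> carrier_mat m 1" by (rule carrier_matI) simp_all
  \<comment> \<open>The eigenvalue is the squared norm of \<open>A * v\<close>, so its standard part
    is nonnegative and, being nonzero, positive.\<close>
  have "adj (A * v) * (A * v) = adj v * (adj A * A * v)" by (simp add: mat_assoc)
  also have "\<dots> = l \<cdot>\<^sub>m 1\<^sub>m 1" unfolding e mult_smult_distrib[OF adj_carrier[OF v(1)] v(1)] v(2) ..
  finally have n: "adj (A * v) * (A * v) = l \<cdot>\<^sub>m 1\<^sub>m 1" .
  have "std_mat (adj (A * v) * (A * v)) = adj (std_mat (A * v)) * std_mat (A * v)"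
    by (subst std_mat_mult) (simp_all only: adj_dim std_mat_adj)
  then have q: "adj (std_mat (A * v)) * std_mat (A * v) = std_mat (l \<cdot>\<^sub>m 1\<^sub>m 1)" unfolding n ..
  have "(adj (std_mat (A * v)) * std_mat (A * v)) $$ (0, 0) = std_part l" unfolding q by simp
  then have "std_part l = of_real (\<Sum>i<m. (cmod (std_mat (A * v) $$ (i, 0)))\<^sup>2)"
    by (subst (asm) gram_index) auto
  then have "Re (std_part l) \<ge> 0" by (simp only: Re_complex_of_real) (intro sum_nonneg, simp)
  moreover have "cnj (std_part l) = std_part l" "cnj (inf_part l) = inf_part l"
    using arg_cong[OF cl, of std_part] arg_cong[OF cl, of inf_part] by simp_all
  ultimately have "positive_appreciable l"
    using l0 by (auto simp: positive_appreciable_def is_dual_number_def Reals_cnj_iff complex_eq_iff order_less_le)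
  then obtain \<mu> \<kappa> where \<mu>: "positive_appreciable \<mu>" "\<mu> * \<mu> = l" "\<kappa> * \<mu> = 1" "conjugate \<mu> = \<mu>" "conjugate \<kappa> = \<kappa>"
    by (rule positive_appreciable_sqrt)
  define u where "u = \<kappa> \<cdot>\<^sub>m (A * v)"
  have u: "u \<in> carrier_mat m 1" by (rule carrier_matI) (simp_all add: u_def)
  have "adj u * u = \<kappa> \<cdot>\<^sub>m (\<kappa> \<cdot>\<^sub>m (adj (A * v) * (A * v)))"
    unfolding u_def adj_smult \<mu>(5)
    by (simp only: mult_smult_assoc_mat[OF adj_carrier[OF Av] smult_carrier_mat[OF Av]]
        mult_smult_distrib[OF adj_carrier[OF Av] Av])
  also have "\<dots> = (\<kappa> * \<mu>) * (\<kappa> * \<mu>) \<cdot>\<^sub>m 1\<^sub>m 1"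
    unfolding n \<mu>(2)[symmetric] by (rule eq_matI) (simp_all add: mult_ac)
  also have "\<dots> = 1\<^sub>m 1" unfolding \<mu>(3) by (rule eq_matI) simp_all
  finally have uu: "adj u * u = 1\<^sub>m 1" .
  have "\<mu> \<cdot>\<^sub>m u = (\<kappa> * \<mu>) \<cdot>\<^sub>m (A * v)"
    unfolding u_def by (rule eq_matI) (simp_all add: mult_ac)
  moreover have "1 \<cdot>\<^sub>m (A * v) = A * v" by (rule eq_matI) simp_all
  ultimately have Avu: "A * v = \<mu> \<cdot>\<^sub>m u" by (simp only: \<mu>(3))
  have "adj A * u = \<kappa> \<cdot>\<^sub>m (adj A * A * v)"
    unfolding u_def mult_smult_distrib[OF adj_carrier[OF A] Av] by (simp add: mat_assoc)
  also have "\<dots> = (\<kappa> * \<mu>) * \<mu> \<cdot>\<^sub>m v" unfolding e \<mu>(2)[symmetric] by (rule eq_matI) (simp_all add: mult_ac)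
  finally have "adj A * u = \<mu> \<cdot>\<^sub>m v" unfolding \<mu>(3) by simp
  then show thesis using u v uu Avu \<mu> by (intro that[of u v \<mu>])
qed

lemma diag_block_assoc:
  assumes "A \<in> carrier_mat a a'" "B \<in> carrier_mat b b'" "C \<in> carrier_mat c c'"
  shows "four_block_mat A (0\<^sub>m a (b' + c')) (0\<^sub>m (b + c) a') (four_block_mat B (0\<^sub>m b c') (0\<^sub>m c b') C) =
    four_block_mat (four_block_mat A (0\<^sub>m a b') (0\<^sub>m b a') B) (0\<^sub>m (a + b) c') (0\<^sub>m c (a' + b')) C"
  using assms[THEN carrier_matD(1)] assms[THEN carrier_matD(2)] by (intro eq_matI) auto

text \<open>Sizes are given as \<open>r + m'\<close> and \<open>r + n'\<close> to keep truncated
  subtraction out of the induction over the rows.\<close>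

lemma partial_svd:
  assumes "A \<in> carrier_mat m n"
  shows "\<exists>U V r m' n' S R. m = r + m' \<and> n = r + n' \<and> unitary m U \<and> unitary n V \<and>
    S \<in> carrier_mat r r \<and> R \<in> carrier_mat m' n' \<and> diagonal_mat S \<and> (\<forall>i<r. positive_appreciable (S $$ (i, i))) \<and>
    std_mat R = 0\<^sub>m m' n' \<and> adj U * A * V = four_block_mat S (0\<^sub>m r n') (0\<^sub>m m' r) R"
  using assms
proof (induction m arbitrary: n A)
  case 0
  note [simp] = carrier_matD[OF 0]
  have "adj (1\<^sub>m 0) * A * 1\<^sub>m n = four_block_mat (0\<^sub>m 0 0) (0\<^sub>m 0 n) (0\<^sub>m 0 0) (0\<^sub>m 0 n)"
    by (rule eq_matI) simp_all
  then show ?case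
    by (intro exI[of _ "1\<^sub>m 0"] exI[of _ "1\<^sub>m n"] exI[of _ 0] exI[of _ n] exI[of _ "0\<^sub>m 0 0"] exI[of _ "0\<^sub>m 0 n"])
       (simp add: diagonal_mat_def, rule eq_matI, simp_all)
next
  case (Suc m)
  note A = Suc.prems
  show ?case
  proof (cases "std_mat A = 0\<^sub>m (Suc m) n")
    case True
    have "A = four_block_mat (0\<^sub>m 0 0) (0\<^sub>m 0 n) (0\<^sub>m (Suc m) 0) A"
      using carrier_matD[OF A] by (intro eq_matI) auto
    moreover have "adj (1\<^sub>m (Suc m)) * A * 1\<^sub>m n = A" using A carrier_matD[OF A] by simp
    ultimately show ?thesis using True A
      by (intro exI[of _ "1\<^sub>m (Suc m)"] exI[of _ "1\<^sub>m n"] exI[of _ 0] exI[of _ "Suc m"] exI[of _ n]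
          exI[of _ "0\<^sub>m 0 0"] exI[of _ A]) (simp add: diagonal_mat_def)
  next
    case False
    obtain u v \<mu> where u: "u \<in> carrier_mat (Suc m) 1" "adj u * u = 1\<^sub>m 1" and v: "v \<in> carrier_mat n 1" "adj v * v = 1\<^sub>m 1"
      and Av: "A * v = \<mu> \<cdot>\<^sub>m u" and Au: "adj A * u = \<mu> \<cdot>\<^sub>m v" and \<mu>: "positive_appreciable \<mu>" "conjugate \<mu> = \<mu>"
      using dual_singular_triple[OF A False] by blast
    \<comment> \<open>A nonzero standard part forces at least one column, so a column can be split
      off along with the row.\<close>
    have "n \<noteq> 0" using False A carrier_matD[OF A] by (metis dim_row_mat(1) eq_matI index_map_mat(2,3) index_zero_mat(2,3) not_less_zero)
    then obtain n0 where n: "n = Suc n0" by (cases n) auto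
    note A = A[unfolded n] and v = v[unfolded n]
    obtain U where U: "unitary (Suc m) U" and Uu: "\<And>i. i < Suc m \<Longrightarrow> U $$ (i, 0) = u $$ (i, 0)"
      using dual_unitary_completion[OF u] by blast
    obtain V where V: "unitary (Suc n0) V" and Vv: "\<And>i. i < Suc n0 \<Longrightarrow> V $$ (i, 0) = v $$ (i, 0)"
      using dual_unitary_completion[OF v] by blast
    obtain A' where A': "A' \<in> carrier_mat m n0"
      and fb: "adj U * A * V = four_block_mat (\<mu> \<cdot>\<^sub>m 1\<^sub>m 1) (0\<^sub>m 1 n0) (0\<^sub>m m 1) A'"
      using deflation[OF U V A u(1) Uu v(1) Vv Av Au \<mu>(2)] by auto
    obtain U' V' r m' n' S R where IH: "m = r + m'" "n0 = r + n'" "unitary m U'" "unitary n0 V'"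
      "S \<in> carrier_mat r r" "R \<in> carrier_mat m' n'" "diagonal_mat S" "\<forall>i<r. positive_appreciable (S $$ (i, i))"
      "std_mat R = 0\<^sub>m m' n'" "adj U' * A' * V' = four_block_mat S (0\<^sub>m r n') (0\<^sub>m m' r) R"
      using Suc.IH[OF A'] by blast
    note [simp] = unitaryD(1,2)[OF U] unitaryD(1,2)[OF V] unitaryD(1,2)[OF IH(3)] unitaryD(1,2)[OF IH(4)] carrier_matD[OF A] carrier_matD[OF IH(5)]
    let ?U = "U * block_ext 1 U'" and ?V = "V * block_ext 1 V'"
    let ?S = "four_block_mat (\<mu> \<cdot>\<^sub>m 1\<^sub>m 1) (0\<^sub>m 1 r) (0\<^sub>m r 1) S"
    have "adj ?U * A * ?V = adj (block_ext 1 U') * (adj U * A * V) * block_ext 1 V'" by (simp add: mat_assoc)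
    also have "\<dots> = four_block_mat (\<mu> \<cdot>\<^sub>m 1\<^sub>m 1) (0\<^sub>m 1 n0) (0\<^sub>m m 1) (adj U' * A' * V')"
      unfolding fb by (rule block_ext_conj[OF _ A' IH(3,4) refl]) simp
    also have "\<dots> = four_block_mat ?S (0\<^sub>m (1 + r) n') (0\<^sub>m m' (1 + r)) R"
      unfolding IH(10) unfolding IH(1,2) by (rule diag_block_assoc) (auto simp: IH)
    finally have "adj ?U * A * ?V = four_block_mat ?S (0\<^sub>m (Suc r) n') (0\<^sub>m m' (Suc r)) R" by simp
    moreover have "?S \<in> carrier_mat (Suc r) (Suc r)" by (rule carrier_matI) simp_all
    moreover have "diagonal_mat ?S" using IH(7) by (auto simp: diagonal_mat_def)
    moreover have "\<forall>i<Suc r. positive_appreciable (?S $$ (i, i))"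
      using IH(8) \<mu> by (auto simp: less_Suc_eq_0_disj)
    moreover have "unitary (Suc m) ?U" "unitary n ?V"
      using unitary_mult[OF U] unitary_block_ext[OF IH(3), of 1] unitary_mult[OF V] unitary_block_ext[OF IH(4), of 1]
      by (simp_all add: n)
    moreover have "Suc m = Suc r + m'" "n = Suc r + n'" using IH(1,2) n by simp_all
    ultimately show ?thesis using IH(6,9) by blast
  qed
qed

section \<open>Diagonalising the infinitesimal remainder\<close>

abbreviation dual_lift :: "complex mat \<Rightarrow> dual_complex mat" where
  "dual_lift \<equiv> map_mat (\<lambda>z. DC z 0)"

lemma dual_lift_parts [simp]: "std_mat (dual_lift M) = M" "inf_mat (dual_lift M) = 0\<^sub>m (dim_row M) (dim_col M)"
  by (rule eq_matI; simp)+

lemma std_mat_one [simp]: "std_mat (1\<^sub>m n) = 1\<^sub>m n"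
  by (rule eq_matI) auto

lemma unitary_std_mat:
  assumes "unitary n U"
  shows "unitary n (std_mat U)"
proof -
  note u = unitaryD[OF assms]
  have "std_mat (adj U * U) = 1\<^sub>m n" "std_mat (U * adj U) = 1\<^sub>m n" unfolding u by simp_all
  then show ?thesis using assms by (simp add: unitary_def)
qed

lemma unitary_dual_lift:
  assumes "unitary n U"
  shows "unitary n (dual_lift U)"
proof -
  note u = unitaryD[OF assms]
  have "adj (dual_lift U) * dual_lift U = 1\<^sub>m n" "dual_lift U * adj (dual_lift U) = 1\<^sub>m n"
    by (rule dual_mat_eqI; simp add: u; auto intro!: eq_matI simp: u)+
  then show ?thesis using assms by (simp add: unitary_def)
qed

text \<open>The dual result is reused: in \<open>partial_svd\<close> of the lifted matrix the
  remainder vanishes on passing to standard parts, so what is left is fully diagonal with positive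
  entries and zeros.\<close>

lemma complex_svd:
  fixes M :: "complex mat"
  assumes M: "M \<in> carrier_mat m n"
  obtains U V where "unitary m U" "unitary n V" "diagonal_mat (adj U * M * V)"
    "\<And>i. i < m \<Longrightarrow> i < n \<Longrightarrow> (adj U * M * V) $$ (i, i) \<in> \<real> \<and> 0 \<le> Re ((adj U * M * V) $$ (i, i))"
proof -
  obtain U V r m' n' S R where h: "m = r + m'" "n = r + n'" "unitary m U" "unitary n V"
    "S \<in> carrier_mat r r" "R \<in> carrier_mat m' n'" "diagonal_mat S" "\<forall>i<r. positive_appreciable (S $$ (i, i))"
    "std_mat R = 0\<^sub>m m' n'" "adj U * dual_lift M * V = four_block_mat S (0\<^sub>m r n') (0\<^sub>m m' r) R"
    using partial_svd[of "dual_lift M" m n] M by auto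
  note [simp] = carrier_matD[OF M] unitaryD(1,2)[OF h(3)] unitaryD(1,2)[OF h(4)] carrier_matD[OF h(5)] carrier_matD[OF h(6)]
  have D: "adj (std_mat U) * M * std_mat V = std_mat (four_block_mat S (0\<^sub>m r n') (0\<^sub>m m' r) R)"
    unfolding h(10)[symmetric] by simp
  have R: "std_part (R $$ (i, j)) = 0" if "i < m'" "j < n'" for i j
    using arg_cong[OF h(9), of "\<lambda>M. M $$ (i, j)"] that by simp
  show thesis
  proof (rule that[OF unitary_std_mat[OF h(3)] unitary_std_mat[OF h(4)]])
    show "diagonal_mat (adj (std_mat U) * M * std_mat V)"
      unfolding D using h(7) R by (auto simp: diagonal_mat_def)
    fix i assume i: "i < m" "i < n"
    show "(adj (std_mat U) * M * std_mat V) $$ (i, i) \<in> \<real> \<and> 0 \<le> Re ((adj (std_mat U) * M * std_mat V) $$ (i, i))"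
      unfolding D using h(1,2,8) R i
      by (auto simp: positive_appreciable_def is_dual_number_def intro: less_imp_le)
  qed
qed

lemma unitary_dc_eq_unitary:
  assumes "U \<in> carrier_mat n n"
  shows "unitary_dc U \<longleftrightarrow> unitary n U"
  using assms carrier_matD[OF assms] by (auto simp: unitary_dc_def unitary_def conj_transpose_eq_adj)

lemma svd_exists:
  assumes A: "A \<in> carrier_mat m n"
  obtains U S1 S2 V where "is_svd A U S1 S2 V"
proof -
  obtain U V r m' n' S R where h: "m = r + m'" "n = r + n'" "unitary m U" "unitary n V"
    "S \<in> carrier_mat r r" "R \<in> carrier_mat m' n'" "diagonal_mat S" "\<forall>i<r. positive_appreciable (S $$ (i, i))"
    "std_mat R = 0\<^sub>m m' n'" "adj U * A * V = four_block_mat S (0\<^sub>m r n') (0\<^sub>m m' r) R"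
    using partial_svd[OF A] by blast
  have "inf_mat R \<in> carrier_mat m' n'" using h(6) by simp
  then obtain U' V' where U': "unitary m' U'" and V': "unitary n' V'" and dg: "diagonal_mat (adj U' * inf_mat R * V')"
    and nn: "\<And>i. i < m' \<Longrightarrow> i < n' \<Longrightarrow> (adj U' * inf_mat R * V') $$ (i, i) \<in> \<real> \<and> 0 \<le> Re ((adj U' * inf_mat R * V') $$ (i, i))"
    by (rule complex_svd) (rule that)
  note [simp] = carrier_matD[OF A] unitaryD(1,2)[OF h(3)] unitaryD(1,2)[OF h(4)] carrier_matD[OF h(5)] carrier_matD[OF h(6)]
    unitaryD(1,2)[OF U'] unitaryD(1,2)[OF V']
  \<comment> \<open>As \<open>R\<close> has no standard part, these constant lifts act on
    \<open>inf_mat R\<close> exactly as \<open>U'\<close> and \<open>V'\<close> do.\<close>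
  define U2 where "U2 = dual_lift U'"
  define V2 where "V2 = dual_lift V'"
  have U2: "unitary m' U2" and V2: "unitary n' V2" using unitary_dual_lift U' V' by (simp_all add: U2_def V2_def)
  note [simp] = unitaryD(1,2)[OF U2] unitaryD(1,2)[OF V2]
  define S2 where "S2 = adj U2 * R * V2"
  have S2: "S2 \<in> carrier_mat m' n'" by (rule carrier_matI) (simp_all add: S2_def)
  note [simp] = carrier_matD[OF S2]
  have "std_mat S2 = adj U' * std_mat R * V'" by (simp add: S2_def U2_def V2_def)
  then have s: "std_mat S2 = 0\<^sub>m m' n'" unfolding h(9) by simp
  have i: "inf_mat S2 = adj U' * inf_mat R * V'"
  proof -
    have "std_mat (adj U2 * R) = 0\<^sub>m m' n'" "inf_mat (adj U2 * R) = adj U' * inf_mat R"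
      by (simp_all add: h(9) U2_def) (auto intro!: eq_matI)
    moreover have "inf_mat S2 = std_mat (adj U2 * R) * inf_mat V2 + inf_mat (adj U2 * R) * std_mat V2"
      unfolding S2_def by (rule inf_mat_mult) simp
    ultimately have "inf_mat S2 = 0\<^sub>m m' n' + adj U' * inf_mat R * V'" by (simp add: V2_def)
    then show ?thesis by (auto intro!: eq_matI)
  qed
  have s0: "std_part (S2 $$ (i, j)) = 0" if "i < m'" "j < n'" for i j
    using arg_cong[OF s, of "\<lambda>M. M $$ (i, j)"] that by simp
  have i0: "inf_part (S2 $$ (i, j)) = (adj U' * inf_mat R * V') $$ (i, j)" if "i < m'" "j < n'" for i j
    using arg_cong[OF i, of "\<lambda>M. M $$ (i, j)"] that by simp
  define W where "W = U * block_ext r U2"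
  define X where "X = V * block_ext r V2"
  have W: "unitary m W" and X: "unitary n X"
    using unitary_mult[OF h(3)] unitary_block_ext[OF U2, of r] unitary_mult[OF h(4)] unitary_block_ext[OF V2, of r] h(1,2)
    by (simp_all add: W_def X_def)
  have "adj W * A * X = adj (block_ext r U2) * (adj U * A * V) * block_ext r V2"
    using h(1,2) by (simp add: W_def X_def mat_assoc)
  also have "\<dots> = four_block_mat S (0\<^sub>m r n') (0\<^sub>m m' r) S2"
    unfolding h(10) S2_def by (rule block_ext_conj[OF h(5,6) U2 V2 refl])
  finally have D: "adj W * A * X = four_block_mat S (0\<^sub>m r n') (0\<^sub>m m' r) S2" .
  have "W * (adj W * A * X) * adj X = A" by (rule unitary_conj_cancel[OF W X A])
  note A_eq = this[unfolded D, symmetric]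
  have "diagonal_mat S2"
    unfolding diagonal_mat_def using s0 i0 dg by (auto intro!: dual_complex_eqI simp: diagonal_mat_def)
  \<comment> \<open>The infinitesimal part is real and nonnegative, which leaves exactly the two
    alternatives.\<close>
  moreover have "positive_infinitesimal (S2 $$ (i, i)) \<or> S2 $$ (i, i) = 0" if "i < m'" "i < n'" for i
    using s0[OF that] i0[OF that] nn[OF that]
    by (auto simp: positive_infinitesimal_def is_dual_number_def complex_is_Real_iff order_le_less
        intro!: dual_complex_eqI complex_eqI simp del: index_mult_mat)
  moreover have cW: "W \<in> carrier_mat m m" "X \<in> carrier_mat n n" using W X by (simp_all add: unitary_def)
  ultimately have "is_svd A W S S2 X"
    unfolding is_svd_def conj_transpose_eq_adj using A h S2 W X A_eq
    by (intro exI[of _ m] exI[of _ n] exI[of _ r]) (simp add: unitary_dc_eq_unitary[OF cW(1)] unitary_dc_eq_unitary[OF cW(2)])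
  then show thesis by (rule that)
qed

section \<open>Identification with the new dual Moore-Penrose inverse\<close>

lemma dual_complex_inverse:
  assumes "std_part x \<noteq> 0"
  shows "\<exists>y. x * y = 1"
  using assms by (intro exI[of _ "DC (1 / std_part x) (- inf_part x / (std_part x * std_part x))"])
    (auto intro!: dual_complex_eqI)

lemma diagonal_inverse:
  fixes S :: "'a::comm_ring_1 mat"
  assumes S: "S \<in> carrier_mat r r" "diagonal_mat S" and inv: "\<And>i. i < r \<Longrightarrow> \<exists>y. S $$ (i, i) * y = 1"
  obtains S' where "S' \<in> carrier_mat r r" "S * S' = 1\<^sub>m r" "S' * S = 1\<^sub>m r"
proof -
  obtain f where f: "\<And>i. i < r \<Longrightarrow> S $$ (i, i) * f i = 1" using inv by metis
  define S' where "S' = mat r r (\<lambda>(i, j). if i = j then f i else 0)"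
  have S': "S' \<in> carrier_mat r r" "diagonal_mat S'" by (simp_all add: S'_def diagonal_mat_def)
  note [simp] = carrier_matD[OF S(1)] carrier_matD[OF S'(1)]
  have "(S * S') $$ (i, j) = 1\<^sub>m r $$ (i, j)" "(S' * S) $$ (i, j) = 1\<^sub>m r $$ (i, j)" if ij: "i < r" "j < r" for i j
    unfolding diagonal_mult_index[OF S S'(1) ij] diagonal_mult_index[OF S' S(1) ij]
    using ij f[of i] S(2) by (auto simp: S'_def diagonal_mat_def mult.commute)
  then have "S * S' = 1\<^sub>m r" "S' * S = 1\<^sub>m r" by (rule_tac eq_matI, simp_all del: index_mult_mat(1))+
  then show thesis using S' that by blast
qed

text \<open>The inner unitary factors cancel in every product. The second claim keeps track of the
  matrix from which the essential part is read off.\<close>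

lemma dual_pinv_unitary:
  assumes D: "D \<in> carrier_mat m n" and U: "unitary m U" and V: "unitary n V" and Y: "dual_pinv D Y"
  shows "dual_pinv (U * D * adj V) (V * Y * adj U)"
    "U * D * adj V * (V * Y * adj U) * (U * D * adj V) = U * (D * Y * D) * adj V"
proof -
  note [simp] = carrier_matD[OF D] unitaryD(1,2)[OF U] unitaryD(1,2)[OF V] dual_pinvD(1,2)[OF Y]
  have VV: "adj V * (V * X) = X" if "dim_row X = n" for X
  proof -
    have "adj V * (V * X) = 1\<^sub>m n * X" using that by (simp add: mat_assoc[symmetric] unitaryD(3)[OF V])
    then show ?thesis using that by simp
  qed
  have UU: "adj U * (U * X) = X" if "dim_row X = m" for X
  proof -
    have "adj U * (U * X) = 1\<^sub>m m * X" using that by (simp add: mat_assoc[symmetric] unitaryD(3)[OF U])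
    then show ?thesis using that by simp
  qed
  let ?A = "U * D * adj V" and ?X = "V * Y * adj U"
  have 1: "?A * ?X = U * (D * Y) * adj U" and 2: "?X * ?A = V * (Y * D) * adj V"
    and 3: "?A * ?X * ?A = U * (D * Y * D) * adj V" and 4: "?X * ?A * ?X = V * (Y * D * Y) * adj U"
    by (simp_all add: mat_assoc VV UU)
  show "?A * ?X * ?A = U * (D * Y * D) * adj V" by (fact 3)
  have "std_mat (U * (D * Y * D) * adj V) = std_mat U * std_mat (D * Y * D) * std_mat (adj V)"
    by (subst std_mat_mult, simp, subst std_mat_mult) simp_all
  also have "\<dots> = std_mat ?A" unfolding dual_pinvD(3)[OF Y] by simp
  finally have s: "std_mat (?A * ?X * ?A) = std_mat ?A" unfolding 3 .
  have "adj (?A * ?X) = U * adj (D * Y) * adj U" "adj (?X * ?A) = V * adj (Y * D) * adj V"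
    unfolding 1 2 by (simp_all add: mat_assoc)
  then have h: "adj (?A * ?X) = ?A * ?X" "adj (?X * ?A) = ?X * ?A"
    by (simp_all only: 1 2 dual_pinvD(5,6)[OF Y])
  have "?X * ?A * ?X = ?X" unfolding 4 by (simp only: dual_pinvD(4)[OF Y])
  moreover have "?X \<in> carrier_mat (dim_col ?A) (dim_row ?A)" by (rule carrier_matI) simp_all
  ultimately show "dual_pinv ?A ?X" unfolding dual_pinv_def using s h by blast
qed

text \<open>The witness is the inverse of \<open>S\<close> padded with zeros. It erases the block
  \<open>R\<close>, which is invisible to standard parts.\<close>

lemma dual_pinv_diag:
  assumes S: "S \<in> carrier_mat r r" "diagonal_mat S" "\<And>i. i < r \<Longrightarrow> positive_appreciable (S $$ (i, i))"
    and R: "R \<in> carrier_mat m n" "\<And>i j. i < m \<Longrightarrow> j < n \<Longrightarrow> std_part (R $$ (i, j)) = 0"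
  obtains Y where "dual_pinv (four_block_mat S (0\<^sub>m r n) (0\<^sub>m m r) R) Y"
    "four_block_mat S (0\<^sub>m r n) (0\<^sub>m m r) R * Y * four_block_mat S (0\<^sub>m r n) (0\<^sub>m m r) R =
      four_block_mat S (0\<^sub>m r n) (0\<^sub>m m r) (0\<^sub>m m n)"
proof -
  have "\<exists>y. S $$ (i, i) * y = 1" if "i < r" for i
    using S(3)[OF that] by (intro dual_complex_inverse) (auto simp: positive_appreciable_def)
  then obtain S' where S': "S' \<in> carrier_mat r r" "S * S' = 1\<^sub>m r" "S' * S = 1\<^sub>m r"
    using diagonal_inverse[OF S(1,2)] by blast
  define D where "D = four_block_mat S (0\<^sub>m r n) (0\<^sub>m m r) R"
  define Y where "Y = four_block_mat S' (0\<^sub>m r m) (0\<^sub>m n r) (0\<^sub>m n m)"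
  note [simp] = carrier_matD[OF S(1)] carrier_matD[OF S'(1)] carrier_matD[OF R(1)]
  note fb = four_block_diag_mult
  have DY: "D * Y = four_block_mat (1\<^sub>m r) (0\<^sub>m r m) (0\<^sub>m m r) (0\<^sub>m m m)"
    unfolding D_def Y_def by (subst fb[OF S(1) R(1) S'(1) zero_carrier_mat]) (simp add: S')
  have YD: "Y * D = four_block_mat (1\<^sub>m r) (0\<^sub>m r n) (0\<^sub>m n r) (0\<^sub>m n n)"
    unfolding D_def Y_def by (subst fb[OF S'(1) zero_carrier_mat S(1) R(1)]) (simp add: S')
  have DYD: "D * Y * D = four_block_mat S (0\<^sub>m r n) (0\<^sub>m m r) (0\<^sub>m m n)"
    unfolding DY unfolding D_def
    by (subst fb[OF one_carrier_mat zero_carrier_mat S(1) R(1)]) (use S(1) in simp)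
  have YDY: "Y * D * Y = Y"
    unfolding YD unfolding Y_def
    by (subst fb[OF one_carrier_mat zero_carrier_mat S'(1) zero_carrier_mat]) (use S'(1) in simp)
  have "adj (D * Y) = D * Y"
    unfolding DY by (subst adj_four_block[OF one_carrier_mat zero_carrier_mat zero_carrier_mat zero_carrier_mat]) simp
  moreover have "adj (Y * D) = Y * D"
    unfolding YD by (subst adj_four_block[OF one_carrier_mat zero_carrier_mat zero_carrier_mat zero_carrier_mat]) simp
  moreover have "std_mat (D * Y * D) = std_mat D"
    unfolding DYD unfolding D_def by (rule eq_matI) (auto simp: R)
  moreover have "Y \<in> carrier_mat (dim_col D) (dim_row D)"
    by (rule carrier_matI) (simp_all add: D_def Y_def)
  ultimately have "dual_pinv D Y" using YDY by (simp only: dual_pinv_def)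
  then show thesis using DYD unfolding D_def by (rule that)
qed

text \<open>The dimensions are read off from the matrices to match the body of
  \<open>essential_part\<close> with its let unfolded.\<close>

abbreviation essential_of_svd :: "dual_complex mat \<Rightarrow> dual_complex mat \<Rightarrow> dual_complex mat \<Rightarrow> dual_complex mat \<Rightarrow> dual_complex mat"
  where "essential_of_svd A U S V \<equiv>
    U * four_block_mat S (0\<^sub>m (dim_row S) (dim_col A - dim_row S)) (0\<^sub>m (dim_row A - dim_row S) (dim_row S))
          (0\<^sub>m (dim_row A - dim_row S) (dim_col A - dim_row S)) * conj_transpose V"

lemma svd_dual_pinv:
  assumes "is_svd A U S1 S2 V"
  obtains X where "dual_pinv A X" "A * X * A = essential_of_svd A U S1 V"
proof -
  obtain m n r where h: "r \<le> m" "r \<le> n" "A \<in> carrier_mat m n" "U \<in> carrier_mat m m" "V \<in> carrier_mat n n"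
    "S1 \<in> carrier_mat r r" "S2 \<in> carrier_mat (m - r) (n - r)" "unitary_dc U" "unitary_dc V"
    "diagonal_mat S1" "\<forall>i<r. positive_appreciable (S1 $$ (i, i))" "diagonal_mat S2"
    "\<forall>i<min (m - r) (n - r). positive_infinitesimal (S2 $$ (i, i)) \<or> S2 $$ (i, i) = 0"
    "A = U * four_block_mat S1 (0\<^sub>m r (n - r)) (0\<^sub>m (m - r) r) S2 * conj_transpose V"
    using assms unfolding is_svd_def by blast
  have U: "unitary m U" and V: "unitary n V" using h unitary_dc_eq_unitary by blast+
  have s0: "std_part (S2 $$ (i, j)) = 0" if "i < m - r" "j < n - r" for i j
    using h(12,13) that carrier_matD[OF h(7)]
    by (cases "i = j") (auto simp: diagonal_mat_def positive_infinitesimal_def)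
  let ?D = "four_block_mat S1 (0\<^sub>m r (n - r)) (0\<^sub>m (m - r) r) S2"
  obtain Y where Y: "dual_pinv ?D Y"
    and DYD: "?D * Y * ?D = four_block_mat S1 (0\<^sub>m r (n - r)) (0\<^sub>m (m - r) r) (0\<^sub>m (m - r) (n - r))"
    using dual_pinv_diag[OF h(6,10) _ h(7) s0] h(11) by blast
  have D: "?D \<in> carrier_mat m n"
    using h(1,2) carrier_matD[OF h(6)] carrier_matD[OF h(7)] by (intro carrier_matI) simp_all
  have "dual_pinv A (V * Y * adj U)" "A * (V * Y * adj U) * A = essential_of_svd A U S1 V"
    using dual_pinv_unitary[OF D U V Y] carrier_matD[OF h(6)] carrier_matD[OF h(3)]
    unfolding h(14)[unfolded conj_transpose_eq_adj, symmetric] DYD conj_transpose_eq_adj by simp_all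
  then show thesis by (rule that)
qed

lemma dual_pinv_exists:
  obtains X where "dual_pinv A X"
proof -
  obtain U S1 S2 V where "is_svd A U S1 S2 V" by (rule svd_exists[OF carrier_mat_triv])
  then show thesis using svd_dual_pinv that by blast
qed

text \<open>Two decompositions are never compared directly: each yields a pseudoinverse, all
  pseudoinverses coincide, and so every decomposition produces the same matrix.\<close>

lemma essential_part_eq:
  assumes X: "dual_pinv A X"
  shows "essential_part A = A * X * A"
proof -
  have ess: "essential_of_svd A U S1 V = A * X * A" if "is_svd A U S1 S2 V" for U S1 S2 V
    using svd_dual_pinv[OF that] dual_pinv_unique[OF X] by metis
  obtain U S1 S2 V where "is_svd A U S1 S2 V" by (rule svd_exists[OF carrier_mat_triv])
  then show ?thesis
    unfolding essential_part_def Let_def using ess by (intro the_equality) metis+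
qed

text \<open>Any \<open>Y\<close> with the defining properties has
  \<open>A * Y * A = A * X * A\<close>, whose standard part is that of \<open>A\<close>; so
  \<open>Y\<close> is a pseudoinverse too, and uniqueness applies.\<close>

lemma ndmpi_eq:
  assumes X: "dual_pinv A X"
  shows "ndmpi A = X"
  unfolding ndmpi_def
proof (rule the_equality)
  show "is_ndmpi A X"
    using X unfolding is_ndmpi_def essential_part_eq[OF X] conj_transpose_eq_adj dual_pinv_def by simp
  fix Y assume Y: "is_ndmpi A Y"
  then have "A * Y * A = A * X * A" unfolding is_ndmpi_def essential_part_eq[OF X] by blast
  then have "dual_pinv A Y"
    using Y dual_pinvD(3)[OF X] unfolding is_ndmpi_def conj_transpose_eq_adj dual_pinv_def by (simp only: simp_thms)
  then show "Y = X" using X by (rule dual_pinv_unique)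
qed

lemma dual_pinv_ndmpi: "dual_pinv A (ndmpi A)"
  using dual_pinv_exists ndmpi_eq by metis

theorem theorem3p5:
  fixes A B :: "dual_complex mat" and m q n :: nat
  assumes "A \<in> carrier_mat m q" and "B \<in> carrier_mat q n"
    and "ndmpi A * A * B * conj_transpose B * conj_transpose A * A * B * ndmpi B
         = B * conj_transpose B * conj_transpose A * A"
  shows "ndmpi (A * B) = ndmpi B * ndmpi A"
  by (rule ndmpi_eq)
     (rule dual_pinv_mult[OF assms(1,2) dual_pinv_ndmpi dual_pinv_ndmpi assms(3)[unfolded conj_transpose_eq_adj]])

end
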